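(* Let $m\ge2$, $1\le\kappa\le m-1$ and $n\ge1$ be arbitrary, and let $\{V_j:1\le j\le n\}$ be linear subspaces of $\mathbb R^m$ of dimension $\kappa$. Then any real-valued polynomial that is simply nondegenerate relative to $\{V_j\}$ has the power decay property relative to $\{V_j\}$ in every open set. More precisely, let $d\in\mathbb N$ and $c>0$, let $\eta\in C^1(\mathbb R^m)$ be compactly supported, and let $L=\prod_{j=1}^n(w_j\cdot\nabla)$ where each $w_j\in V_j^\perp$ is a unit vector. Then there exist $C<\infty$ and $\varepsilon>0$ such that for any real-valued polynomial $P$ of degree $\le d$ on $\mathbb R^m$ with $\max_{|x|\le1}|L(P)(x)|\ge c$, $$|\Lambda_\lambda(f_1,\dots,f_n)|\le C(1+|\lambda|)^{-\varepsilon}\prod_{j=1}^n\|f_j\|_{L^\infty}$$ for all functions $f_j\in L^\infty(V_j)$ and all $\lambda\in\mathbb R$.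
   Context: $\pi_j$ denotes the orthogonal projection of $\mathbb R^m$ onto $V_j$, and $V_j^\perp$ the orthogonal complement of $V_j$. For $\lambda\in\mathbb R$, a real-valued polynomial $P$ on $\mathbb R^m$, a compactly supported $\eta\in C^1(\mathbb R^m)$ and functions $f_j:V_j\to\mathbb C$, define $$\Lambda_\lambda(f_1,\dots,f_n)=\int_{\mathbb R^m}e^{i\lambda P(x)}\prod_{j=1}^n f_j(\pi_j(x))\,\eta(x)\,dx .$$ Simply nondegenerate: $P$ is simply nondegenerate relative to $\{V_j\}$ if there exists a differential operator $L=\prod_{j=1}^n(w_j\cdot\nabla)$, with each $w_j\in V_j^\perp$, such that $L(P)$ does not vanish identically. Power decay property: $P$ has the power decay property relative to $\{V_j\}$ on an open set $U\subset\mathbb R^m$ if for any $\eta\in C^1_0(U)$ ($C^1$ with compact support in $U$) there exist $\varepsilon>0$ and $C<\infty$ such that $|\Lambda_\lambda(f_1,\dots,f_n)|\le C(1+|\lambda|)^{-\varepsilon}\prod_j\|f_j\|_{L^\infty}$ for all $f_j\in L^\infty(V_j)$ and all $\lambda\in\mathbb R$; moreover, for $\eta$ supported in any fixed compact set, $\varepsilon$ may be taken independent of $\eta$, and $C=O(\|\eta\|_{C^1})$. *)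

theory Defs
  imports "HOL-Analysis.Analysis" "HOL-Probability.Essential_Supremum"
begin

definition poly_degree_le :: "nat \<Rightarrow> (real ^ 'm \<Rightarrow> real) \<Rightarrow> bool" where
  "poly_degree_le d P \<longleftrightarrow>
     (\<exists>a. \<forall>x. P x = (\<Sum>\<alpha> | (\<Sum>i\<in>UNIV. \<alpha> i) \<le> d. a \<alpha> * (\<Prod>i\<in>UNIV. x $ i ^ \<alpha> i)))"

lemma finite_multi_indices: "finite {\<alpha> :: 'm::finite \<Rightarrow> nat. (\<Sum>i\<in>UNIV. \<alpha> i) \<le> d}"
proof (rule finite_subset)
  show "{\<alpha> :: 'm \<Rightarrow> nat. (\<Sum>i\<in>UNIV. \<alpha> i) \<le> d} \<subseteq> PiE UNIV (\<lambda>_. {..d})"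
  proof
    fix \<alpha> :: "'m \<Rightarrow> nat" assume *: "\<alpha> \<in> {\<alpha>. (\<Sum>i\<in>UNIV. \<alpha> i) \<le> d}"
    have "\<alpha> i \<le> (\<Sum>i\<in>UNIV. \<alpha> i)" for i
      by (rule member_le_sum) auto
    with * show "\<alpha> \<in> PiE UNIV (\<lambda>_. {..d})"
      by (auto intro: order_trans)
  qed
  show "finite (PiE (UNIV :: 'm set) (\<lambda>_. {..d}))"
    by (rule finite_PiE) auto
qed

definition orth_proj :: "'a::euclidean_space set \<Rightarrow> 'a \<Rightarrow> 'a" where
  "orth_proj V x = (THE v. v \<in> V \<and> x - v \<in> V\<^sup>\<bottom>)"

lemma orth_proj_unique:
  fixes V :: "'a::euclidean_space set"
  assumes "subspace V"
  shows "\<exists>!v. v \<in> V \<and> x - v \<in> V\<^sup>\<bottom>"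
proof -
  have "x \<in> V + V\<^sup>\<bottom>"
    using subspace_sum_orthogonal_comp[OF assms] by simp
  then obtain v w where vw: "v \<in> V" "w \<in> V\<^sup>\<bottom>" "x = v + w"
    by (rule set_plus_elim)
  show ?thesis
  proof (rule ex1I[of _ v])
    show "v \<in> V \<and> x - v \<in> V\<^sup>\<bottom>"
      using vw by simp
  next
    fix u assume u: "u \<in> V \<and> x - u \<in> V\<^sup>\<bottom>"
    have 1: "u - v \<in> V"
      using assms u vw subspace_diff by blast
    have "(x - v) - (x - u) \<in> V\<^sup>\<bottom>"
    proof (rule subspace_diff[OF subspace_orthogonal_comp])
      show "x - v \<in> V\<^sup>\<bottom>" "x - u \<in> V\<^sup>\<bottom>"
        using u vw(2,3) by simp_all
    qed
    then have "u - v \<in> V\<^sup>\<bottom>"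
      by simp
    with 1 have "orthogonal (u - v) (u - v)"
      unfolding orthogonal_comp_def by blast
    then show "u = v"
      by (simp add: orthogonal_self)
  qed
qed

definition dir_deriv :: "'a::real_normed_vector \<Rightarrow> ('a \<Rightarrow> real) \<Rightarrow> 'a \<Rightarrow> real" where
  "dir_deriv w P x = frechet_derivative P (at x) w"

text \<open>The operator \<open>\<Prod>j=1..n. w j \<bullet> \<nabla>\<close>.\<close>

primrec dir_deriv_prod ::
  "(nat \<Rightarrow> 'a::real_normed_vector) \<Rightarrow> nat \<Rightarrow> ('a \<Rightarrow> real) \<Rightarrow> 'a \<Rightarrow> real" where
  "dir_deriv_prod w 0 P = P"
| "dir_deriv_prod w (Suc k) P = dir_deriv (w (Suc k)) (dir_deriv_prod w k P)"

definition simply_nondegenerate ::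
  "(nat \<Rightarrow> 'a::euclidean_space set) \<Rightarrow> nat \<Rightarrow> ('a \<Rightarrow> real) \<Rightarrow> bool" where
  "simply_nondegenerate V n P \<longleftrightarrow>
     (\<exists>w. (\<forall>j\<in>{1..n}. w j \<in> (V j)\<^sup>\<bottom>) \<and> (\<exists>x. dir_deriv_prod w n P x \<noteq> 0))"

definition orthonormal_basis :: "'a::euclidean_space set \<Rightarrow> 'a set \<Rightarrow> bool" where
  "orthonormal_basis V B \<longleftrightarrow>
     B \<subseteq> V \<and> span B = V \<and> pairwise orthogonal B \<and> (\<forall>b\<in>B. norm b = 1)"

lemma orthonormal_basis_exists:
  assumes "subspace V"
  shows "\<exists>B. orthonormal_basis V B"
proof (rule orthonormal_basis_subspace[OF assms])
  fix B
  assume "B \<subseteq> V" "span B = V" "pairwise orthogonal B" and nrm: "\<And>x. x \<in> B \<Longrightarrow> norm x = 1"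
  moreover from nrm have "\<forall>b\<in>B. norm b = 1"
    by (rule ballI)
  ultimately have "orthonormal_basis V B"
    unfolding orthonormal_basis_def by (intro conjI)
  then show "\<exists>B. orthonormal_basis V B" ..
qed

text \<open>
  Lebesgue measure of dimension \<open>dim V\<close> on a linear subspace \<open>V\<close>: the analogue of
  \<open>lborel_eq\<close> with the standard basis replaced by an orthonormal basis of \<open>V\<close>, then completed.
  By rotation invariance of Lebesgue measure the choice of the basis is immaterial.
\<close>

definition subspace_lebesgue :: "'a::euclidean_space set \<Rightarrow> 'a measure" where
  "subspace_lebesgue V =
     (let B = (SOME B. orthonormal_basis V B)
      in completion (distr (\<Pi>\<^sub>M b\<in>B. (lborel :: real measure)) (restrict_space borel V)
           (\<lambda>t. \<Sum>b\<in>B. t b *\<^sub>R b)))"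

text \<open>
  A function on \<open>V\<close> is represented by a function on the ambient space, whose values off \<open>V\<close>
  play no role.
\<close>

definition Linf :: "'a::euclidean_space set \<Rightarrow> ('a \<Rightarrow> complex) set" where
  "Linf V = {f. f \<in> borel_measurable (subspace_lebesgue V) \<and>
                esssup (subspace_lebesgue V) (\<lambda>y. ereal (norm (f y))) < \<infinity>}"

definition Linf_norm :: "'a::euclidean_space set \<Rightarrow> ('a \<Rightarrow> complex) \<Rightarrow> real" where
  "Linf_norm V f = real_of_ereal (esssup (subspace_lebesgue V) (\<lambda>y. ereal (norm (f y))))"

definition C1_fun :: "('a::euclidean_space \<Rightarrow> complex) \<Rightarrow> bool" where
  "C1_fun \<eta> \<longleftrightarrow> (\<forall>x. \<eta> differentiable (at x)) \<and>
     (\<forall>v. continuous_on UNIV (\<lambda>x. frechet_derivative \<eta> (at x) v))"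

definition supp :: "('a::euclidean_space \<Rightarrow> complex) \<Rightarrow> 'a set" where
  "supp \<eta> = closure {x. \<eta> x \<noteq> 0}"

definition C1_norm :: "('a::euclidean_space \<Rightarrow> complex) \<Rightarrow> real" where
  "C1_norm \<eta> = (SUP x. norm (\<eta> x)) + (SUP x. onorm (frechet_derivative \<eta> (at x)))"

definition osc_form ::
  "(nat \<Rightarrow> 'a::euclidean_space set) \<Rightarrow> nat \<Rightarrow> ('a \<Rightarrow> real) \<Rightarrow> ('a \<Rightarrow> complex) \<Rightarrow> real \<Rightarrow>
   (nat \<Rightarrow> 'a \<Rightarrow> complex) \<Rightarrow> complex" where
  "osc_form V n P \<eta> lam f =
     (LINT x|lebesgue. exp (\<i> * of_real (lam * P x)) * (\<Prod>j=1..n. f j (orth_proj (V j) x)) * \<eta> x)"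

text \<open>
  In the second conjunct \<open>A\<close> is the constant implicit in \<open>C = O(C1_norm \<eta>)\<close>; like the
  exponent, it may depend on the compact set \<open>K\<close> but not on \<open>\<eta>\<close>.
\<close>

definition power_decay ::
  "(nat \<Rightarrow> 'a::euclidean_space set) \<Rightarrow> nat \<Rightarrow> ('a \<Rightarrow> real) \<Rightarrow> 'a set \<Rightarrow> bool" where
  "power_decay V n P U \<longleftrightarrow>
     (\<forall>\<eta>. C1_fun \<eta> \<and> compact (supp \<eta>) \<and> supp \<eta> \<subseteq> U \<longrightarrow>
        (\<exists>\<epsilon> > 0. \<exists>C. \<forall>f lam. (\<forall>j\<in>{1..n}. f j \<in> Linf (V j)) \<longrightarrow>
           norm (osc_form V n P \<eta> lam f)
             \<le> C * (1 + \<bar>lam\<bar>) powr (- \<epsilon>) * (\<Prod>j=1..n. Linf_norm (V j) (f j)))) \<and>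
     (\<forall>K. compact K \<and> K \<subseteq> U \<longrightarrow>
        (\<exists>\<epsilon> > 0. \<exists>A. \<forall>\<eta>. C1_fun \<eta> \<and> supp \<eta> \<subseteq> K \<longrightarrow>
           (\<forall>f lam. (\<forall>j\<in>{1..n}. f j \<in> Linf (V j)) \<longrightarrow>
              norm (osc_form V n P \<eta> lam f)
                \<le> A * C1_norm \<eta> * (1 + \<bar>lam\<bar>) powr (- \<epsilon>) * (\<Prod>j=1..n. Linf_norm (V j) (f j)))))"

end

(* Averaging over translations along w_n, which leave f_n o pi_n unchanged, and applying the
   Cauchy-Schwarz inequality removes f_n and replaces the phase P by P(x + t w_n) - P(x). The
   operator L_(n-1) turns this phase into a difference of L_(n-1) P, which is a polynomial in t
   with large derivative at t = 0, hence is large for most t, and induction on n applies. For n = 1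
   the van der Corput estimate along w_1 suffices. The bounds depend on P only through a lower
   bound for |L(P)| at one point, so lambda is absorbed into P throughout. *)

theory Submission
  imports Defs "HOL-Computational_Algebra.Polynomial" "HOL-Probability.Probability_Measure"
begin

section \<open>Coefficient norms and sublevel sets of real polynomials\<close>

text \<open>The obstacle is uniformity. The induction hypothesis is applied to a different phase for
  each t, with shifted products as factors and amplitude, so its constants may depend only on the
  directions, a degree bound, the support radius and Lipschitz constant of the amplitude, and the
  radius of a ball containing the point where L(P) is evaluated. To this end the size of a
  polynomial on [0, 1] is measured by the l^1 norm of its coefficients, and interpolation at
  separated nodes gives an explicit bound for the set where it is much smaller than that norm. All
  estimates have the form C * max 1 |q| powr (- e): such a quantity stays bounded where q is small,
  so exceptional t do no harm, and its average along a segment is bounded by a quantity of the same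
  form with a smaller exponent. The functions f_j o pi_j enter only as bounded Borel functions
  invariant along w_j, a class visibly preserved by passing from F to F(x + t v) times the conjugate
  of F(x). Since f_j is merely Lebesgue measurable on V_j, it must first be changed on a null set;
  this is harmless because preimages of null sets under an orthogonal projection are null.\<close>

definition coeff_norm :: "real poly \<Rightarrow> real" where
  "coeff_norm p = (\<Sum>i\<le>degree p. \<bar>coeff p i\<bar>)"

lemma coeff_norm_eq: "degree p \<le> D \<Longrightarrow> coeff_norm p = (\<Sum>i\<le>D. \<bar>coeff p i\<bar>)"
  unfolding coeff_norm_def by (rule sum.mono_neutral_left) (auto simp: coeff_eq_0)

lemma coeff_norm_nonneg [simp]: "0 \<le> coeff_norm p"
  by (simp add: coeff_norm_def sum_nonneg)

lemma coeff_norm_const [simp]: "coeff_norm [:c:] = \<bar>c\<bar>"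
  by (simp add: coeff_norm_def)

lemma coeff_norm_add: "coeff_norm (p + q) \<le> coeff_norm p + coeff_norm q"
proof -
  let ?D = "max (degree p) (degree q)"
  have "coeff_norm (p + q) = (\<Sum>i\<le>?D. \<bar>coeff p i + coeff q i\<bar>)"
    using coeff_norm_eq[OF degree_add_le[of p ?D q]] by simp
  also have "\<dots> \<le> (\<Sum>i\<le>?D. \<bar>coeff p i\<bar> + \<bar>coeff q i\<bar>)"
    by (intro sum_mono abs_triangle_ineq)
  also have "\<dots> = coeff_norm p + coeff_norm q"
    by (simp add: sum.distrib coeff_norm_eq[of p ?D] coeff_norm_eq[of q ?D])
  finally show ?thesis .
qed

lemma coeff_norm_smult [simp]: "coeff_norm (smult c p) = \<bar>c\<bar> * coeff_norm p"
  by (cases "c = 0") (auto simp: coeff_norm_def abs_mult sum_distrib_left)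

lemma coeff_norm_pCons_0: "coeff_norm (pCons 0 p) = coeff_norm p"
proof -
  have "coeff_norm (pCons 0 p) = (\<Sum>i\<le>Suc (degree p). \<bar>coeff (pCons 0 p) i\<bar>)"
    by (intro coeff_norm_eq degree_pCons_le)
  then show ?thesis
    by (simp add: sum.atMost_Suc_shift coeff_norm_def del: sum.atMost_Suc)
qed

text \<open>Here p = (X - a) q + p(a), and multiplication by X leaves the coefficient norm
  unchanged. This is one step of Newton interpolation: it trades a node for a degree.\<close>

lemma coeff_norm_synthetic_div:
  "coeff_norm p \<le> \<bar>poly p a\<bar> + (1 + \<bar>a\<bar>) * coeff_norm (synthetic_div p a)"
proof -
  let ?q = "synthetic_div p a"
  have "p = pCons 0 ?q + smult (- a) ?q + [:poly p a:]"
    using synthetic_div_correct'[of a p] by simp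
  then have "coeff_norm p \<le> coeff_norm (pCons 0 ?q + smult (- a) ?q) + \<bar>poly p a\<bar>"
    using coeff_norm_add[of "pCons 0 ?q + smult (- a) ?q" "[:poly p a:]"] by simp
  also have "coeff_norm (pCons 0 ?q + smult (- a) ?q) \<le> coeff_norm ?q + \<bar>a\<bar> * coeff_norm ?q"
    using coeff_norm_add[of "pCons 0 ?q" "smult (- a) ?q"]
    unfolding coeff_norm_pCons_0 coeff_norm_smult by simp
  finally show ?thesis by (simp add: algebra_simps)
qed

lemma poly_le_coeff_norm:
  assumes "\<bar>s\<bar> \<le> 1" shows "\<bar>poly p s\<bar> \<le> coeff_norm p"
proof -
  have "\<bar>poly p s\<bar> \<le> (\<Sum>i\<le>degree p. \<bar>coeff p i * s ^ i\<bar>)"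
    unfolding poly_altdef by (rule sum_abs)
  also have "\<dots> \<le> coeff_norm p"
    unfolding coeff_norm_def
    by (intro sum_mono) (simp add: abs_mult power_abs mult_left_le power_le_one assms)
  finally show ?thesis .
qed

lemma coeff_norm_pderiv:
  assumes "degree p \<le> d" shows "coeff_norm (pderiv p) \<le> real d * coeff_norm p"
proof -
  have "coeff_norm (pderiv p) = (\<Sum>i\<le>d. real (Suc i) * \<bar>coeff p (Suc i)\<bar>)"
    using coeff_norm_eq[of "pderiv p" d] assms
    by (simp add: coeff_pderiv abs_mult degree_pderiv del: of_nat_Suc)
  also have "\<dots> \<le> (\<Sum>i\<le>d. real d * \<bar>coeff p (Suc i)\<bar>)"
  proof (intro sum_mono)
    fix i
    show "real (Suc i) * \<bar>coeff p (Suc i)\<bar> \<le> real d * \<bar>coeff p (Suc i)\<bar>"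
    proof (cases "Suc i \<le> degree p")
      case True
      then have "Suc i \<le> d" using assms by simp
      then show ?thesis by (intro mult_right_mono) auto
    qed (simp add: coeff_eq_0)
  qed
  also have "\<dots> \<le> real d * (\<Sum>i\<le>Suc d. \<bar>coeff p i\<bar>)"
    unfolding sum_distrib_left[symmetric]
    by (intro mult_left_mono) (auto simp: sum.atMost_Suc_shift simp del: sum.atMost_Suc)
  also have "(\<Sum>i\<le>Suc d. \<bar>coeff p i\<bar>) = coeff_norm p"
    using assms by (intro coeff_norm_eq[symmetric]) auto
  finally show ?thesis .
qed

text \<open>Read backwards: a derivative that is large at one point of [-1, 1] forces large
  coefficients. In this form the nondegeneracy of the phase enters the induction step.\<close>

lemma poly_pderiv_le_coeff_norm:
  assumes "\<bar>s\<bar> \<le> 1" "degree p \<le> d" shows "\<bar>poly (pderiv p) s\<bar> \<le> real d * coeff_norm p"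
  using poly_le_coeff_norm[OF assms(1), of "pderiv p"] coeff_norm_pderiv[OF assms(2)] by linarith

text \<open>Interpolation one node at a time: dividing by X - a leaves a quotient of lower degree
  whose values at the other nodes are at most 2 \<delta> / r. Since |a| \<le> 1,
  \<open>coeff_norm_synthetic_div\<close> costs another factor 2, so each node contributes 4 / r;
  the extra \<delta> is absorbed into the 5 because r \<le> 1.\<close>

lemma coeff_norm_interpolation:
  fixes p :: "real poly"
  assumes "finite S" "card S = Suc d" "S \<subseteq> {0..1}" "degree p \<le> d" "0 < r" "r \<le> 1"
    and "\<And>s. s \<in> S \<Longrightarrow> \<bar>poly p s\<bar> \<le> \<delta>"
    and "\<And>s t. s \<in> S \<Longrightarrow> t \<in> S \<Longrightarrow> s \<noteq> t \<Longrightarrow> r \<le> \<bar>s - t\<bar>"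
  shows "coeff_norm p \<le> 5 ^ d * \<delta> / r ^ d"
  using assms
proof (induction d arbitrary: p S \<delta>)
  case 0
  then obtain c where "p = [:c:]" using degree_eq_zeroE by blast
  moreover obtain s where "s \<in> S" using 0 by (metis card_1_singletonE insertI1 One_nat_def)
  ultimately show ?case using 0(7)[of s] by simp
next
  case (Suc d)
  obtain a where a: "a \<in> S" using Suc.prems(2) by fastforce
  define q where "q = synthetic_div p a"
  have p: "poly p t = (t - a) * poly q t + poly p a" for t
    unfolding q_def
    using arg_cong[OF synthetic_div_correct'[of a p], of "\<lambda>p. poly p t"] by (simp add: algebra_simps)
  have \<delta>: "0 \<le> \<delta>" using Suc.prems(7)[OF a] by linarith
  have "coeff_norm q \<le> 5 ^ d * (2 * \<delta> / r) / r ^ d"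
  proof (rule Suc.IH[of "S - {a}"])
    show "degree q \<le> d"
      using Suc.prems(4) by (simp add: q_def degree_synthetic_div)
    fix s assume s: "s \<in> S - {a}"
    have r: "r \<le> \<bar>s - a\<bar>" using Suc.prems(8)[of s a] s a by auto
    have "\<bar>s - a\<bar> * \<bar>poly q s\<bar> = \<bar>poly p s - poly p a\<bar>"
      using p[of s] by (simp add: abs_mult)
    also have "\<dots> \<le> 2 * \<delta>" using Suc.prems(7)[of s] Suc.prems(7)[OF a] s by auto
    finally have "r * \<bar>poly q s\<bar> \<le> 2 * \<delta>"
      using mult_right_mono[OF r, of "\<bar>poly q s\<bar>"] by simp
    then show "\<bar>poly q s\<bar> \<le> 2 * \<delta> / r" using Suc.prems(5) by (simp add: field_simps)
  qed (use Suc.prems a in auto)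
  then have q: "coeff_norm q \<le> 2 * 5 ^ d * \<delta> / r ^ Suc d" by (simp add: mult_ac)
  have "coeff_norm p \<le> \<bar>poly p a\<bar> + (1 + \<bar>a\<bar>) * coeff_norm q"
    unfolding q_def by (rule coeff_norm_synthetic_div)
  also have "\<dots> \<le> \<delta> + 2 * coeff_norm q"
    using Suc.prems(3) Suc.prems(7)[OF a] a by (intro add_mono mult_right_mono) auto
  also have "\<dots> \<le> \<delta> / r ^ Suc d + 2 * (2 * 5 ^ d * \<delta> / r ^ Suc d)"
  proof (intro add_mono mult_left_mono q)
    have "\<delta> * r ^ Suc d \<le> \<delta> * 1"
      using Suc.prems(5,6) \<delta> by (intro mult_left_mono power_le_one) auto
    then show "\<delta> \<le> \<delta> / r ^ Suc d" using Suc.prems(5) by (simp add: field_simps)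
  qed simp
  also have "\<dots> = (1 + 4 * 5 ^ d) * \<delta> / r ^ Suc d" by (simp add: add_divide_distrib algebra_simps)
  also have "\<dots> \<le> 5 ^ Suc d * \<delta> / r ^ Suc d"
  proof (intro divide_right_mono mult_right_mono)
    have "1 \<le> (5::real) ^ d" by simp
    then show "(1::real) + 4 * 5 ^ d \<le> 5 ^ Suc d" unfolding power_Suc by linarith
  qed (use \<delta> Suc.prems in auto)
  finally show ?case .
qed

text \<open>Greedy choice: the intervals of radius r around the points chosen so far are too short
  in total to cover E, so a further point remains. For k = 0 the hypothesis only says that E has
  positive measure.\<close>

lemma separated_points:
  fixes E :: "real set"
  assumes [measurable]: "E \<in> sets lborel" and "0 < r" "ennreal (2 * r * real k) < emeasure lborel E"
  shows "\<exists>S. finite S \<and> card S = Suc k \<and> S \<subseteq> E \<and> (\<forall>s\<in>S. \<forall>t\<in>S. s \<noteq> t \<longrightarrow> r \<le> \<bar>s - t\<bar>)"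
  using assms(3)
proof (induction k)
  case 0
  then have "E \<noteq> {}" by auto
  then obtain e where "e \<in> E" by blast
  then show ?case by (intro exI[of _ "{e}"]) auto
next
  case (Suc k)
  have "ennreal (2 * r * real k) \<le> ennreal (2 * r * real (Suc k))"
    using \<open>0 < r\<close> by (intro ennreal_leI mult_left_mono) auto
  with Suc.prems have "ennreal (2 * r * real k) < emeasure lborel E" by (rule le_less_trans[rotated])
  with Suc.IH obtain S where S: "finite S" "card S = Suc k" "S \<subseteq> E"
    "\<forall>s\<in>S. \<forall>t\<in>S. s \<noteq> t \<longrightarrow> r \<le> \<bar>s - t\<bar>" by blast
  let ?U = "\<Union>s\<in>S. {s - r .. s + r}"
  have "emeasure lborel ?U \<le> (\<Sum>s\<in>S. emeasure lborel {s - r .. s + r})"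
    by (rule emeasure_subadditive_finite) (auto simp: S)
  also have "\<dots> = (\<Sum>s\<in>S. ennreal (2 * r))" using \<open>0 < r\<close> by simp
  also have "\<dots> = ennreal (2 * r * real (Suc k))"
    using \<open>0 < r\<close> S by (subst sum_ennreal) (auto simp: mult_ac)
  finally have "emeasure lborel ?U < emeasure lborel E" using Suc.prems by (rule le_less_trans)
  moreover have "emeasure lborel E \<le> emeasure lborel ?U" if "E \<subseteq> ?U"
    by (rule emeasure_mono[OF that]) (use S in auto)
  ultimately have "\<not> E \<subseteq> ?U" by (metis not_le)
  then obtain e where e: "e \<in> E" "\<And>s. s \<in> S \<Longrightarrow> e \<notin> {s - r .. s + r}" by blast
  have sep: "r \<le> \<bar>e - s\<bar>" "r \<le> \<bar>s - e\<bar>" if "s \<in> S" for s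
    using e(2)[OF that] by (auto simp: abs_if)
  have "e \<notin> S" using sep[of e] \<open>0 < r\<close> by auto
  then show ?case
    using S e sep by (intro exI[of _ "insert e S"]) auto
qed

lemma poly_sublevel_measure:
  fixes p :: "real poly"
  assumes "degree p \<le> d" "1 \<le> d" "0 < \<delta>" "0 < coeff_norm p"
  shows "measure lborel {s\<in>{0..1}. \<bar>poly p s\<bar> \<le> \<delta>} \<le> 10 * (real d + 1) * (\<delta> / coeff_norm p) powr (1 / d)"
proof -
  define E where "E = {s\<in>{0..1::real}. \<bar>poly p s\<bar> \<le> \<delta>}"
  have "E = {0..1} \<inter> {s. \<bar>poly p s\<bar> \<le> \<delta>}" unfolding E_def by auto
  then have "closed E"
    by (simp only:) (intro closed_Int closed_Collect_le continuous_intros closed_atLeastAtMost)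
  then have E[measurable]: "E \<in> sets lborel" by auto
  define \<mu> where "\<mu> = measure lborel E"
  have "emeasure lborel E \<le> emeasure lborel {0..1::real}"
    by (intro emeasure_mono) (auto simp: E_def)
  then have le1: "emeasure lborel E \<le> 1" by simp
  then have fin: "emeasure lborel E = ennreal \<mu>"
    unfolding \<mu>_def by (intro emeasure_eq_ennreal_measure) (auto simp: top_unique)
  have \<mu>1: "\<mu> \<le> 1" using le1 fin by (simp add: ennreal_le_1)
  have "\<mu> \<le> 10 * (d + 1) * (\<delta> / coeff_norm p) powr (1 / d)"
  proof (cases "\<mu> \<le> 0")
    case True
    then show ?thesis by (rule order_trans) simp
  next
    case False
    then have \<mu>: "0 < \<mu>" by simp
    \<comment> \<open>With d + 1 in place of d the inequality 2 r d < \<mu> is strict, as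
      \<open>separated_points\<close> demands. Solving the interpolation bound for \<mu> then gives
      the constant 10 (d + 1), that is 5 times 2 (d + 1).\<close>
    define r where "r = \<mu> / (2 * (d + 1))"
    have r: "0 < r" "r \<le> 1" using \<mu> \<mu>1 by (auto simp: r_def field_simps)
    have "2 * r * real d < \<mu>" using \<mu> by (simp add: r_def field_simps)
    then have "ennreal (2 * r * real d) < emeasure lborel E" using \<mu> fin r by (simp add: ennreal_less_iff)
    then obtain S where S: "finite S" "card S = Suc d" "S \<subseteq> E"
      "\<forall>s\<in>S. \<forall>t\<in>S. s \<noteq> t \<longrightarrow> r \<le> \<bar>s - t\<bar>" using separated_points[OF E r(1)] by blast
    have "coeff_norm p \<le> 5 ^ d * \<delta> / r ^ d"
      by (rule coeff_norm_interpolation[OF S(1,2) _ assms(1) r]) (use S in \<open>auto simp: E_def\<close>)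
    then have "r ^ d \<le> 5 ^ d * (\<delta> / coeff_norm p)" using r assms by (simp add: field_simps)
    then have "(r / 5) ^ d \<le> \<delta> / coeff_norm p" by (simp add: power_divide field_simps)
    then have "((r / 5) powr d) powr (1 / d) \<le> (\<delta> / coeff_norm p) powr (1 / d)"
      using r by (intro powr_mono2) (auto simp: powr_realpow)
    then have "r / 5 \<le> (\<delta> / coeff_norm p) powr (1 / d)" using assms r by (simp add: powr_powr)
    then show ?thesis by (simp add: r_def field_simps)
  qed
  then show ?thesis by (simp only: \<mu>_def E_def of_nat_mult of_nat_add of_nat_numeral of_nat_1)
qed

section \<open>Oscillatory integrals over the unit interval\<close>

text \<open>A probability measure, so that a constant is its own average: integrals independent of a
  translation parameter can be averaged over it without a change of constants.\<close>

definition unif :: "real measure" where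
  "unif = uniform_measure lborel {0..1}"

lemma prob_space_unif: "prob_space unif"
  unfolding unif_def by (rule prob_space_uniform_measure) auto

interpretation unif: prob_space unif by (rule prob_space_unif)

lemma sets_unif [simp, measurable_cong]: "sets unif = sets borel"
  by (simp add: unif_def)

lemma space_unif [simp]: "space unif = UNIV"
  by (simp add: unif_def)

lemma measure_unif_UNIV [simp]: "measure unif UNIV = 1"
  using unif.prob_space by simp

lemma AE_unif: "AE s in unif. s \<in> {0..1}"
  unfolding unif_def by (rule AE_uniform_measureI) auto

lemma integral_unif:
  fixes f :: "real \<Rightarrow> 'b::{banach, second_countable_topology}"
  assumes "f \<in> borel_measurable borel"
  shows "integral\<^sup>L unif f = (\<integral>s. indicator {0..1} s *\<^sub>R f s \<partial>lborel)"
proof -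
  have "unif = density lborel (\<lambda>s. ennreal (indicator {0..1} s))"
    by (simp add: unif_def uniform_measure_def ennreal_indicator divide_ennreal_def)
  then have "integral\<^sup>L unif f = integral\<^sup>L (density lborel (\<lambda>s. ennreal (indicator {0..1} s))) f"
    by (rule arg_cong)
  also have "\<dots> = (\<integral>s. indicator {0..1} s *\<^sub>R f s \<partial>lborel)"
    using assms by (intro integral_density) auto
  finally show ?thesis .
qed

lemma integrable_unif:
  fixes f :: "real \<Rightarrow> 'b::{banach, second_countable_topology}"
  assumes [measurable]: "f \<in> borel_measurable borel" and "\<And>s. s \<in> {0..1} \<Longrightarrow> norm (f s) \<le> B"
  shows "integrable unif f"
proof (rule unif.integrable_const_bound)
  show "AE s in unif. norm (f s) \<le> B" using AE_unif by eventually_elim (rule assms(2))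
qed simp

lemma norm_integral_unif_le:
  fixes f :: "real \<Rightarrow> 'b::{banach, second_countable_topology}"
  assumes [measurable]: "f \<in> borel_measurable borel" "g \<in> borel_measurable borel"
    and "\<And>s. s \<in> {0..1} \<Longrightarrow> norm (f s) \<le> g s" "\<And>s. s \<in> {0..1} \<Longrightarrow> g s \<le> B"
  shows "norm (integral\<^sup>L unif f) \<le> integral\<^sup>L unif g"
proof -
  have fB: "norm (f s) \<le> B" and gB: "norm (g s) \<le> B" if "s \<in> {0..1}" for s
    using assms(3,4)[OF that] norm_ge_zero[of "f s"] unfolding real_norm_def by linarith+
  have "norm (integral\<^sup>L unif f) \<le> (\<integral>s. norm (f s) \<partial>unif)" by simp
  also have "\<dots> \<le> integral\<^sup>L unif g"
  proof (rule integral_mono_AE)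
    show "AE s in unif. norm (f s) \<le> g s" using AE_unif by eventually_elim (rule assms(3))
    show "integrable unif g" by (rule integrable_unif[OF _ gB]) auto
    show "integrable unif (\<lambda>s. norm (f s))" by (rule integrable_unif[of _ B]) (use fB in auto)
  qed
  finally show ?thesis .
qed

lemma norm_integral_unif_le_const:
  fixes f :: "real \<Rightarrow> 'b::{banach, second_countable_topology}"
  assumes "f \<in> borel_measurable borel" and "\<And>s. s \<in> {0..1} \<Longrightarrow> norm (f s) \<le> B"
  shows "norm (integral\<^sup>L unif f) \<le> B"
  using norm_integral_unif_le[OF assms(1), of "\<lambda>_. B" B] assms(2) by simp

lemma measure_unif:
  assumes "A \<in> sets borel" shows "measure unif A = measure lborel (A \<inter> {0..1})"
  unfolding unif_def by (subst measure_uniform_measure) (use assms in \<open>auto simp: Int_commute\<close>)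

lemma max_1_powr_le_1: "0 \<le> e \<Longrightarrow> max 1 x powr (- e) \<le> (1::real)"
  by (rule order_trans[OF powr_mono[of "-e" 0]]) auto

text \<open>Split at |p| = sqrt N, with N the coefficient norm. By
  \<open>poly_sublevel_measure\<close> the set where |p| is smaller has measure O(N powr (- 1 / (2
  d))), and elsewhere the integrand is at most N powr (- \<epsilon> / 2). The truncation by max 1
  keeps the integrand at most 1 on the small set.\<close>

lemma integral_unif_poly_powr:
  assumes "1 \<le> d" "0 < \<epsilon>"
  obtains C \<epsilon>' where "0 \<le> C" "0 < \<epsilon>'"
    "\<And>p. degree p \<le> d \<Longrightarrow>
       (\<integral>s. max 1 \<bar>poly p s\<bar> powr (- \<epsilon>) \<partial>unif) \<le> C * max 1 (coeff_norm p) powr (- \<epsilon>')"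
proof
  define C where "C = 10 * (real d + 1) + 1"
  define \<epsilon>' where "\<epsilon>' = min (\<epsilon> / 2) (1 / (2 * d))"
  show "0 \<le> C" by (simp add: C_def)
  show "0 < \<epsilon>'" using assms by (simp add: \<epsilon>'_def)
  fix p :: "real poly" assume p: "degree p \<le> d"
  have m [measurable]: "poly p \<in> borel_measurable borel"
    by (intro borel_measurable_continuous_onI continuous_intros)
  show "(\<integral>s. max 1 \<bar>poly p s\<bar> powr (- \<epsilon>) \<partial>unif) \<le> C * max 1 (coeff_norm p) powr (- \<epsilon>')"
  proof (cases "coeff_norm p \<le> 1")
    case True
    have "norm (\<integral>s. max 1 \<bar>poly p s\<bar> powr (- \<epsilon>) \<partial>unif) \<le> 1"
      by (rule norm_integral_unif_le_const) (use assms max_1_powr_le_1 in auto)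
    then show ?thesis using True by (simp add: C_def)
  next
    case False
    define N where "N = coeff_norm p"
    have N: "1 < N" using False by (simp add: N_def)
    define S where "S = {s. \<bar>poly p s\<bar> \<le> sqrt N}"
    have S [measurable]: "S \<in> sets borel" unfolding S_def by measurable
    have pw: "max 1 \<bar>poly p s\<bar> powr (- \<epsilon>) \<le> indicator S s + N powr (- (\<epsilon> / 2))" for s
    proof (cases "s \<in> S")
      case True
      have "max 1 \<bar>poly p s\<bar> powr (- \<epsilon>) \<le> 1" using assms by (intro max_1_powr_le_1) simp
      then show ?thesis using True N by (simp add: add_increasing2)
    next
      case False
      have "max 1 \<bar>poly p s\<bar> powr (- \<epsilon>) \<le> sqrt N powr (- \<epsilon>)"
        using assms False N by (intro powr_mono2') (auto simp: S_def)
      also have "\<dots> = N powr (- (\<epsilon> / 2))" using N by (simp add: powr_half_sqrt[symmetric] powr_powr)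
      finally show ?thesis using False by simp
    qed
    have "norm (\<integral>s. max 1 \<bar>poly p s\<bar> powr (- \<epsilon>) \<partial>unif)
        \<le> (\<integral>s. indicator S s + N powr (- (\<epsilon> / 2)) \<partial>unif)"
      by (rule norm_integral_unif_le[where B = "1 + N powr (- (\<epsilon> / 2))"])
         (use pw in \<open>auto simp: indicator_def\<close>)
    also have "\<dots> = measure unif S + N powr (- (\<epsilon> / 2))"
      by (subst Bochner_Integration.integral_add)
         (auto simp: unif.emeasure_eq_measure)
    also have "measure unif S = measure lborel {s\<in>{0..1}. \<bar>poly p s\<bar> \<le> sqrt N}"
      by (simp add: measure_unif S_def Int_def conj_commute)
    also have "\<dots> \<le> 10 * (real d + 1) * (sqrt N / N) powr (1 / d)"
      using poly_sublevel_measure[OF p assms(1), of "sqrt N"] N unfolding N_def by simp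
    also have "sqrt N / N = N powr (- (1 / 2))"
    proof -
      have "sqrt N / N = N powr (1 / 2) / N powr 1" using N by (simp add: powr_half_sqrt)
      also have "\<dots> = N powr (- (1 / 2))" by (subst powr_diff[symmetric]) simp
      finally show ?thesis .
    qed
    also have "(N powr (- (1 / 2))) powr (1 / d) = N powr (- (1 / (2 * d)))" by (simp add: powr_powr)
    also have "10 * (real d + 1) * N powr (- (1 / (2 * d))) + N powr (- (\<epsilon> / 2))
      \<le> 10 * (real d + 1) * N powr (- \<epsilon>') + N powr (- \<epsilon>')"
      using N by (intro add_mono mult_left_mono powr_mono) (auto simp: \<epsilon>'_def)
    finally show ?thesis using N by (simp add: C_def N_def algebra_simps)
  qed
qed

text \<open>
  Away from the zeros of \<open>p = q'\<close> one integrates by parts; replacing \<open>1 / p\<close> by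
  \<open>p / (p\<^sup>2 + \<delta>\<^sup>2)\<close> makes this possible on the whole interval, at the cost of the error
  \<open>\<delta>\<^sup>2 / (p\<^sup>2 + \<delta>\<^sup>2)\<close>, which is small on average.
\<close>

lemma van_der_Corput_poly:
  assumes "1 \<le> d"
  obtains C a where "0 \<le> C" "0 < a"
    "\<And>q. degree q \<le> d \<Longrightarrow>
       norm (\<integral>s. cis (poly q s) \<partial>unif) \<le> C * max 1 (coeff_norm (pderiv q)) powr (- a)"
proof -
  obtain C\<^sub>0 e\<^sub>0 where C0: "0 \<le> C\<^sub>0" "0 < e\<^sub>0" "\<And>p. degree p \<le> d \<Longrightarrow>
       (\<integral>s. max 1 \<bar>poly p s\<bar> powr (- 1) \<partial>unif) \<le> C\<^sub>0 * max 1 (coeff_norm p) powr (- e\<^sub>0)"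
    using integral_unif_poly_powr[OF assms zero_less_one] by blast
  define a where "a = min (1 / 2) (e\<^sub>0 / 4)"
  define C where "C = 1 + real d + C\<^sub>0"
  have "norm (\<integral>s. cis (poly q s) \<partial>unif) \<le> C * max 1 (coeff_norm (pderiv q)) powr (- a)"
    if q: "degree q \<le> d" for q
  proof (cases "coeff_norm (pderiv q) \<le> 1")
    have [measurable]: "poly q \<in> borel_measurable borel" "(\<lambda>s. cis (poly q s)) \<in> borel_measurable borel"
      by (intro borel_measurable_continuous_onI continuous_intros)+
    {
      case True
      have "norm (\<integral>s. cis (poly q s) \<partial>unif) \<le> 1" by (rule norm_integral_unif_le_const) auto
      then show ?thesis using True C0 by (simp add: C_def)
    next
      case False
      define p where "p = pderiv q"
      define N where "N = coeff_norm p"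
      \<comment> \<open>Boundary terms are of size 1 / \<delta>, the derivative of \<open>g\<close>
        costs d N / \<delta>^2, and the regularisation error decays in N / \<delta>. Any power of N
        strictly between 1/2 and 1 makes all three decay; 3/4 gives N powr (- 3/4), N powr (- 1/2)
        and N powr (- \<open>e\<^sub>0\<close> / 4).\<close>
      define \<delta> where "\<delta> = N powr (3 / 4)"
      have N: "1 < N" using False by (simp add: N_def p_def)
      then have \<delta>: "0 < \<delta>" by (simp add: \<delta>_def)
      have dp: "degree p \<le> d" using q by (simp add: p_def degree_pderiv)
      define D where "D s = (poly p s)\<^sup>2 + \<delta>\<^sup>2" for s
      have D: "0 < D s" for s using \<delta> by (simp add: D_def sum_power2_gt_zero_iff add_nonneg_pos)
      have Dn: "D s \<noteq> 0" for s using D[of s] by simp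
      define g where "g s = poly p s / D s" for s
      define g' where "g' s = poly (pderiv p) s * (\<delta>\<^sup>2 - (poly p s)\<^sup>2) / (D s)\<^sup>2" for s
      have contD [continuous_intros]: "continuous_on A D" for A
        unfolding D_def by (intro continuous_intros)
      have contg [continuous_intros]: "continuous_on A g" "continuous_on A g'" for A
        unfolding g_def g'_def by (intro continuous_intros; simp add: Dn)+
      have [measurable]: "poly p \<in> borel_measurable borel" "g \<in> borel_measurable borel"
          "g' \<in> borel_measurable borel" "D \<in> borel_measurable borel"
        by (intro borel_measurable_continuous_onI continuous_intros)+
      have g: "\<bar>g s\<bar> \<le> 1 / (2 * \<delta>)" for s
      proof -
        have "2 * \<delta> * \<bar>poly p s\<bar> \<le> D s"
          unfolding D_def using sum_squares_bound[of \<delta> "\<bar>poly p s\<bar>"] by (simp add: add.commute)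
        then show ?thesis using D[of s] \<delta> by (simp add: g_def field_simps)
      qed
      have dg: "(g has_real_derivative g' s) (at s within A)" for s A
      proof -
        have "(g has_real_derivative
            (poly (pderiv p) s * D s - poly p s * (2 * poly p s * poly (pderiv p) s)) / (D s * D s)) (at s within A)"
          unfolding g_def D_def using D[of s]
          by (auto intro!: derivative_eq_intros poly_DERIV[THEN DERIV_subset] simp: D_def)
        also have "poly (pderiv p) s * D s - poly p s * (2 * poly p s * poly (pderiv p) s)
           = poly (pderiv p) s * (\<delta>\<^sup>2 - (poly p s)\<^sup>2)"
          by (simp add: D_def algebra_simps power2_eq_square)
        finally show ?thesis by (simp add: g'_def power2_eq_square[of "D s"])
      qed
      have g': "\<bar>g' s\<bar> \<le> real d * N / \<delta>\<^sup>2" if "s \<in> {0..1}" for s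
      proof -
        have "\<bar>g' s\<bar> = \<bar>poly (pderiv p) s\<bar> * \<bar>\<delta>\<^sup>2 - (poly p s)\<^sup>2\<bar> / (D s)\<^sup>2"
          by (simp add: g'_def abs_mult)
        also have "\<dots> \<le> (real d * N) * D s / (D s)\<^sup>2"
          using that poly_pderiv_le_coeff_norm[OF _ dp, of s]
          by (intro divide_right_mono mult_mono) (auto simp: N_def D_def abs_if)
        also have "\<dots> = real d * N / D s" using D[of s] by (simp add: power2_eq_square)
        also have "\<dots> \<le> real d * N / \<delta>\<^sup>2"
          using D[of s] N \<delta> by (intro divide_left_mono) (auto simp: D_def)
        finally show ?thesis .
      qed
      \<comment> \<open>The product rule gives F' = h + k: in \<open>h\<close> the derivative falls
        on the exponential and produces p g, which is close to 1 away from the zeros of p; in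
        \<open>k\<close> it falls on \<open>g\<close>.\<close>
      define F where "F s = g s *\<^sub>R cis (poly q s)" for s
      define h where "h s = (poly p s * g s) *\<^sub>R (\<i> * cis (poly q s))" for s
      define k where "k s = g' s *\<^sub>R cis (poly q s)" for s
      have [measurable]: "h \<in> borel_measurable borel" "k \<in> borel_measurable borel"
        unfolding h_def k_def by (intro borel_measurable_continuous_onI continuous_intros)+
      have dF: "(F has_vector_derivative (h s + k s)) (at s within A)" for s A
        unfolding F_def h_def k_def has_vector_derivative_def
        by (rule has_derivative_eq_rhs, rule has_derivative_scaleR)
           (auto intro!: dg[unfolded has_field_derivative_def] has_derivative_cis
              poly_DERIV[THEN DERIV_subset, unfolded has_field_derivative_def]
              simp: p_def fun_eq_iff algebra_simps scaleR_conv_of_real)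
      have FTC: "(\<integral>s. h s + k s \<partial>unif) = F 1 - F 0"
      proof (subst integral_unif, simp, rule integral_FTC_Icc)
        show "continuous_on {0..1} (\<lambda>s. h s + k s)"
          unfolding h_def k_def by (intro continuous_intros)
      qed (use dF in auto)
      have pg: "\<bar>poly p s * g s\<bar> \<le> 1" for s
        using D[of s] \<delta> by (simp add: g_def D_def power2_eq_square divide_le_eq_1)
      have ik: "integrable unif k"
        by (rule integrable_unif[where B = "real d * N / \<delta>\<^sup>2"]) (use g' in \<open>auto simp: k_def\<close>)
      have ih: "integrable unif h"
        by (rule integrable_unif[where B = 1]) (use pg in \<open>auto simp: h_def norm_mult\<close>)
      have "(\<integral>s. h s \<partial>unif) = F 1 - F 0 - (\<integral>s. k s \<partial>unif)"
        using FTC ik ih by (simp add: eq_diff_eq)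
      then have "norm (\<integral>s. h s \<partial>unif) = norm (F 1 - F 0 - (\<integral>s. k s \<partial>unif))" by simp
      also have "\<dots> \<le> norm (F 1) + norm (F 0) + norm (\<integral>s. k s \<partial>unif)"
        by (intro order_trans[OF norm_triangle_ineq4] add_mono norm_triangle_ineq4 order_refl)
      also have "\<dots> \<le> 1 / (2 * \<delta>) + 1 / (2 * \<delta>) + real d * N / \<delta>\<^sup>2"
        by (intro add_mono norm_integral_unif_le_const) (use g g' in \<open>auto simp: F_def k_def\<close>)
      finally have h: "norm (\<integral>s. h s \<partial>unif) \<le> 1 / \<delta> + real d * N / \<delta>\<^sup>2" by simp
      \<comment> \<open>Since 1 - p g = \<delta>^2 / D, this is exactly what is missing from - i h
        to make up the original integrand.\<close>
      define l where "l s = (\<delta>\<^sup>2 / D s) *\<^sub>R cis (poly q s)" for s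
      have [measurable]: "l \<in> borel_measurable borel"
        unfolding l_def by measurable
      have "\<delta>\<^sup>2 / D s \<le> 1" for s using D[of s] by (simp add: D_def)
      then have il: "integrable unif l"
        by (intro integrable_unif[where B = 1]) (use D in \<open>auto simp: l_def less_imp_le\<close>)
      have hl: "cis (poly q s) = - \<i> * h s + l s" for s
      proof -
        have "poly p s * g s + \<delta>\<^sup>2 / D s = 1"
          using D[of s] by (simp add: g_def add_divide_distrib[symmetric]) (simp add: D_def power2_eq_square)
        then have "cis (poly q s) = (poly p s * g s + \<delta>\<^sup>2 / D s) *\<^sub>R cis (poly q s)" by simp
        moreover have "(c + e) *\<^sub>R z = - \<i> * (c *\<^sub>R (\<i> * z)) + e *\<^sub>R z" for c e z
          by (simp add: scaleR_add_left)
        ultimately show ?thesis unfolding h_def l_def by metis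
      qed
      have p\<delta>: "coeff_norm (smult (1 / \<delta>) p) = N powr (1 / 4)"
        using N \<delta> by (simp add: N_def[symmetric]) (simp add: \<delta>_def powr_minus_divide[symmetric] powr_mult_base
            divide_powr_uminus flip: powr_diff)
      \<comment> \<open>The weight \<delta>^2 / (p^2 + \<delta>^2) is at most min 1 (\<delta> /
        |p|), which is the integrand of \<open>integral_unif_poly_powr\<close> with exponent 1 for
        the polynomial p / \<delta>, whose coefficient norm is N powr (1/4).\<close>
      have "norm (\<integral>s. l s \<partial>unif) \<le> (\<integral>s. max 1 \<bar>poly (smult (1 / \<delta>) p) s\<bar> powr (- 1) \<partial>unif)"
      proof (rule norm_integral_unif_le[where B = 1])
        fix s
        show "norm (l s) \<le> max 1 \<bar>poly (smult (1 / \<delta>) p) s\<bar> powr (- 1)"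
        proof (cases "\<bar>poly p s\<bar> \<le> \<delta>")
          case True
          then have "max 1 (\<bar>poly p s\<bar> / \<delta>) = 1" using \<delta> by (simp add: max_def)
          then show ?thesis using \<delta> D[of s] by (simp add: l_def abs_mult) (simp add: D_def)
        next
          case False
          then have "max 1 (\<bar>poly p s\<bar> / \<delta>) = \<bar>poly p s\<bar> / \<delta>" using \<delta> by (simp add: max_def field_simps)
          moreover have "\<delta>\<^sup>2 / D s \<le> \<delta> / \<bar>poly p s\<bar>"
          proof -
            have "\<delta> * \<bar>poly p s\<bar> \<le> \<bar>poly p s\<bar> * \<bar>poly p s\<bar>" using False by (intro mult_right_mono) auto
            also have "\<dots> \<le> D s" by (simp add: D_def power2_eq_square)
            finally show ?thesis using False \<delta> D[of s] by (simp add: field_simps power2_eq_square)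
          qed
          ultimately show ?thesis using \<delta> D[of s] False by (simp add: l_def abs_mult powr_minus_divide)
        qed
      qed (auto intro!: max_1_powr_le_1 simp: powr_minus_divide)
      also have "\<dots> \<le> C\<^sub>0 * max 1 (N powr (1 / 4)) powr (- e\<^sub>0)"
        using C0(3)[of "smult (1 / \<delta>) p"] dp unfolding p\<delta> by simp
      also have "max 1 (N powr (1 / 4)) = N powr (1 / 4)"
        using N by (simp add: max_def ge_one_powr_ge_zero)
      also have "(N powr (1 / 4)) powr (- e\<^sub>0) = N powr (- (e\<^sub>0 / 4))" by (simp add: powr_powr)
      finally have l: "norm (\<integral>s. l s \<partial>unif) \<le> C\<^sub>0 * N powr (- (e\<^sub>0 / 4))" .
      have "(\<integral>s. cis (poly q s) \<partial>unif) = - \<i> * (\<integral>s. h s \<partial>unif) + (\<integral>s. l s \<partial>unif)"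
        unfolding hl using ih il by simp
      then have "norm (\<integral>s. cis (poly q s) \<partial>unif) \<le> norm (\<integral>s. h s \<partial>unif) + norm (\<integral>s. l s \<partial>unif)"
        using norm_triangle_ineq[of "- \<i> * (\<integral>s. h s \<partial>unif)" "\<integral>s. l s \<partial>unif"]
        by (simp add: norm_mult)
      also have "\<dots> \<le> 1 / \<delta> + real d * N / \<delta>\<^sup>2 + C\<^sub>0 * N powr (- (e\<^sub>0 / 4))" using h l by linarith
      also have "1 / \<delta> = N powr (- (3 / 4))" by (simp add: \<delta>_def powr_minus_divide)
      also have "real d * N / \<delta>\<^sup>2 = real d * N powr (- (1 / 2))"
      proof -
        have "\<delta>\<^sup>2 = N powr (3 / 2)" using N by (simp add: \<delta>_def power2_eq_square flip: powr_add)
        then have "N / \<delta>\<^sup>2 = N powr 1 / N powr (3 / 2)" using N by simp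
        also have "\<dots> = N powr (- (1 / 2))" by (subst powr_diff[symmetric]) simp
        finally show ?thesis by (metis times_divide_eq_right)
      qed
      also have "N powr (- (3 / 4)) + real d * N powr (- (1 / 2)) + C\<^sub>0 * N powr (- (e\<^sub>0 / 4))
        \<le> N powr (- a) + real d * N powr (- a) + C\<^sub>0 * N powr (- a)"
        using N C0 by (intro add_mono mult_left_mono powr_mono) (auto simp: a_def)
      finally show ?thesis using N by (simp add: C_def N_def p_def algebra_simps)
    }
  qed
  moreover have "0 \<le> C" "0 < a" using C0 by (auto simp: C_def a_def)
  ultimately show thesis using that by blast
qed

section \<open>Polynomials on a Euclidean space\<close>

text \<open>A coordinate-free form to which both notions of polynomial in the theorem reduce. Linear
  factors in arbitrary directions and a tracked degree bound make restriction to lines, translation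
  and differentiation provable by rule induction.\<close>

inductive poly_deg :: "nat \<Rightarrow> ('a::euclidean_space \<Rightarrow> real) \<Rightarrow> bool" where
  const: "poly_deg d (\<lambda>x. c)"
| add: "poly_deg d P \<Longrightarrow> poly_deg d Q \<Longrightarrow> poly_deg d (\<lambda>x. P x + Q x)"
| inner_mult: "poly_deg d P \<Longrightarrow> poly_deg (Suc d) (\<lambda>x. (x \<bullet> v) * P x)"
| lift: "poly_deg d P \<Longrightarrow> poly_deg (Suc d) P"

lemma poly_deg_mono: "poly_deg d P \<Longrightarrow> d \<le> e \<Longrightarrow> poly_deg e P"
  by (induction e rule: nat_induct) (auto intro: poly_deg.lift simp: le_Suc_eq)

lemma poly_deg_cmult: "poly_deg d P \<Longrightarrow> poly_deg d (\<lambda>x. c * P x)"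
proof (induction rule: poly_deg.induct)
  case (inner_mult d P v)
  from poly_deg.inner_mult[OF inner_mult.IH, of v] show ?case by (simp add: mult_ac)
qed (auto intro: poly_deg.intros simp: distrib_left)

lemma poly_deg_diff: "poly_deg d P \<Longrightarrow> poly_deg d Q \<Longrightarrow> poly_deg d (\<lambda>x. P x - Q x)"
  using poly_deg.add[of d P "\<lambda>x. - 1 * Q x"] poly_deg_cmult[of d Q "- 1"] by simp

lemma poly_deg_sum: "(\<And>i. i \<in> A \<Longrightarrow> poly_deg d (P i)) \<Longrightarrow> poly_deg d (\<lambda>x. \<Sum>i\<in>A. P i x)"
  by (induction A rule: infinite_finite_induct) (auto intro: poly_deg.intros)

lemma poly_deg_mult: "poly_deg d P \<Longrightarrow> poly_deg e Q \<Longrightarrow> poly_deg (d + e) (\<lambda>x. P x * Q x)"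
proof (induction rule: poly_deg.induct)
  case (const d c)
  then show ?case by (intro poly_deg_mono[OF poly_deg_cmult]) auto
next
  case (inner_mult d P v)
  from poly_deg.inner_mult[OF inner_mult.IH[OF inner_mult.prems], of v] show ?case by (simp add: mult_ac)
qed (auto intro: poly_deg.intros simp: distrib_right)

lemma poly_deg_inner: "poly_deg (Suc d) (\<lambda>x. x \<bullet> v)"
  using poly_deg.inner_mult[OF poly_deg.const[of d 1], of v] by simp

lemma poly_deg_power: "poly_deg k (\<lambda>x. (x \<bullet> v) ^ k)"
  by (induction k) (auto intro: poly_deg.intros)

lemma poly_deg_prod:
  "finite A \<Longrightarrow> (\<And>i. i \<in> A \<Longrightarrow> poly_deg (k i) (P i)) \<Longrightarrow> poly_deg (\<Sum>i\<in>A. k i) (\<lambda>x. \<Prod>i\<in>A. P i x)"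
  by (induction A rule: finite_induct) (auto intro: poly_deg.const poly_deg_mult)

lemma poly_deg_translate: "poly_deg d P \<Longrightarrow> poly_deg d (\<lambda>x. P (x + a))"
proof (induction rule: poly_deg.induct)
  case (inner_mult d P v)
  have "poly_deg (Suc d) (\<lambda>x. (x \<bullet> v) * P (x + a) + (a \<bullet> v) * P (x + a))"
    by (intro poly_deg.intros poly_deg_cmult inner_mult.IH)
  then show ?case by (simp add: inner_add_left distrib_right)
qed (auto intro: poly_deg.intros)

lemma poly_deg_line:
  "poly_deg d P \<Longrightarrow> \<exists>q. degree q \<le> d \<and> (\<forall>t. P (x + t *\<^sub>R v) = poly q t)"
proof (induction rule: poly_deg.induct)
  case (const d c)
  show ?case by (rule exI[of _ "[:c:]"]) simp
next
  case (add d P Q)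
  then obtain p q where "degree p \<le> d" "\<forall>t. P (x + t *\<^sub>R v) = poly p t"
    "degree q \<le> d" "\<forall>t. Q (x + t *\<^sub>R v) = poly q t" by blast
  then show ?case by (intro exI[of _ "p + q"]) (auto intro: degree_add_le)
next
  case (inner_mult d P u)
  then obtain p where p: "degree p \<le> d" "\<forall>t. P (x + t *\<^sub>R v) = poly p t" by blast
  have "degree ([:x \<bullet> u, v \<bullet> u:] * p) \<le> Suc d"
    using degree_mult_le[of "[:x \<bullet> u, v \<bullet> u:]" p] degree_pCons_le[of "x \<bullet> u" "[:v \<bullet> u:]"] p(1) by simp
  with p(2) show ?case
    by (intro exI[of _ "[:x \<bullet> u, v \<bullet> u:] * p"]) (auto simp: inner_add_left algebra_simps)
qed (auto intro: le_SucI)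

lemma dir_deriv_eq: "(P has_derivative P') (at x) \<Longrightarrow> dir_deriv w P x = P' w"
  unfolding dir_deriv_def by (metis frechet_derivative_at)

lemma poly_deg_differentiable: "poly_deg d P \<Longrightarrow> P differentiable (at x)"
  by (induction rule: poly_deg.induct)
     (auto intro!: derivative_intros differentiable_add differentiable_mult)

lemma poly_deg_has_derivative:
  "poly_deg d P \<Longrightarrow> (P has_derivative (\<lambda>w. dir_deriv w P x)) (at x)"
  unfolding dir_deriv_def
  using frechet_derivative_works[of P "at x"] poly_deg_differentiable[of d P x] by simp

lemma poly_deg_continuous_on: "poly_deg d P \<Longrightarrow> continuous_on A P"
  by (meson continuous_at_imp_continuous_on differentiable_imp_continuous_within poly_deg_differentiable)

lemma poly_deg_measurable: "poly_deg d P \<Longrightarrow> P \<in> borel_measurable borel"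
  by (intro borel_measurable_continuous_onI poly_deg_continuous_on)

lemma dir_deriv_add:
  assumes "poly_deg d P" "poly_deg e Q"
  shows "dir_deriv w (\<lambda>x. P x + Q x) = (\<lambda>x. dir_deriv w P x + dir_deriv w Q x)"
  by (intro ext dir_deriv_eq has_derivative_add assms[THEN poly_deg_has_derivative])

lemma dir_deriv_diff:
  assumes "poly_deg d P" "poly_deg e Q"
  shows "dir_deriv w (\<lambda>x. P x - Q x) = (\<lambda>x. dir_deriv w P x - dir_deriv w Q x)"
  by (intro ext dir_deriv_eq has_derivative_diff assms[THEN poly_deg_has_derivative])

lemma dir_deriv_cmult:
  assumes "poly_deg d P"
  shows "dir_deriv w (\<lambda>x. c * P x) = (\<lambda>x. c * dir_deriv w P x)"
  by (intro ext dir_deriv_eq has_derivative_mult_right assms[THEN poly_deg_has_derivative])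

lemma dir_deriv_translate:
  assumes "poly_deg d P"
  shows "dir_deriv w (\<lambda>x. P (x + a)) = (\<lambda>x. dir_deriv w P (x + a))"
proof (intro ext dir_deriv_eq)
  fix x
  have "((\<lambda>x. x + a) has_derivative (\<lambda>x. x)) (at x)" by (auto intro!: derivative_eq_intros)
  from has_derivative_compose[OF this poly_deg_has_derivative[OF assms]]
  show "((\<lambda>x. P (x + a)) has_derivative (\<lambda>w. dir_deriv w P (x + a))) (at x)" by simp
qed

text \<open>Keeping the bound \<open>d\<close> lets a single degree serve the whole induction on n,
  since the constants of the one-variable estimates depend on an upper bound for the degree
  only.\<close>

lemma poly_deg_dir_deriv: "poly_deg d P \<Longrightarrow> poly_deg d (dir_deriv w P)"
proof (induction rule: poly_deg.induct)
  case (const d c)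
  have "dir_deriv w (\<lambda>x. c) = (\<lambda>x::'a. 0)" by (intro ext dir_deriv_eq has_derivative_const)
  then show ?case by (simp add: poly_deg.const)
next
  case (add d P Q)
  then show ?case by (simp add: dir_deriv_add[of d P d Q] poly_deg.add)
next
  case (inner_mult d P v)
  have "dir_deriv w (\<lambda>x. (x \<bullet> v) * P x) = (\<lambda>x. (x \<bullet> v) * dir_deriv w P x + (w \<bullet> v) * P x)"
    using poly_deg_has_derivative[OF inner_mult.hyps]
    by (intro ext dir_deriv_eq) (auto intro!: derivative_eq_intros)
  then show ?case
    by (simp add: poly_deg.inner_mult poly_deg.add poly_deg_cmult poly_deg.lift inner_mult)
qed (auto intro: poly_deg.lift)

lemma poly_pderiv_line:
  assumes "poly_deg d P" "\<And>t. P (x + t *\<^sub>R v) = poly q t"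
  shows "poly (pderiv q) t = dir_deriv v P (x + t *\<^sub>R v)"
proof -
  have "((\<lambda>t. x + t *\<^sub>R v) has_derivative (\<lambda>h. h *\<^sub>R v)) (at t)"
    by (auto intro!: derivative_eq_intros)
  from has_derivative_compose[OF this poly_deg_has_derivative[OF assms(1)]]
  have 1: "(poly q has_derivative (\<lambda>h. dir_deriv (h *\<^sub>R v) P (x + t *\<^sub>R v))) (at t)"
    by (simp add: assms(2))
  have "(\<lambda>h. dir_deriv (h *\<^sub>R v) P (x + t *\<^sub>R v)) = (*) (poly (pderiv q) t)"
    by (rule has_derivative_unique[OF 1 poly_DERIV[unfolded has_field_derivative_def]])
  from fun_cong[OF this, of 1] show ?thesis by simp
qed

lemma poly_deg_dir_deriv_prod: "poly_deg d P \<Longrightarrow> poly_deg d (dir_deriv_prod w k P)"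
  by (induction k) (auto intro: poly_deg_dir_deriv)

lemma dir_deriv_prod_cmult:
  "poly_deg d P \<Longrightarrow> dir_deriv_prod w k (\<lambda>x. c * P x) = (\<lambda>x. c * dir_deriv_prod w k P x)"
  by (induction k) (auto intro: dir_deriv_cmult poly_deg_dir_deriv_prod)

text \<open>Constant-coefficient operators are linear and commute with translations. Hence the phase
  P(x + t v) - P(x) of the induction step is again controlled through the derivatives of P
  itself.\<close>

lemma dir_deriv_prod_difference:
  assumes "poly_deg d P"
  shows "dir_deriv_prod w k (\<lambda>x. P (x + a) - P x) =
    (\<lambda>x. dir_deriv_prod w k P (x + a) - dir_deriv_prod w k P x)"
proof (induction k)
  case (Suc k)
  have *: "poly_deg d (dir_deriv_prod w k P)" by (rule poly_deg_dir_deriv_prod[OF assms])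
  show ?case
    by (simp add: Suc dir_deriv_diff[OF poly_deg_translate[OF *] *] dir_deriv_translate[OF *])
qed simp

lemma poly_deg_if_poly_degree_le:
  fixes P :: "real ^ 'm \<Rightarrow> real"
  assumes "poly_degree_le d P" shows "poly_deg d P"
proof -
  obtain a where P: "P = (\<lambda>x. \<Sum>\<alpha> | (\<Sum>i\<in>UNIV. \<alpha> i) \<le> d. a \<alpha> * (\<Prod>i\<in>UNIV. (x \<bullet> axis i 1) ^ \<alpha> i))"
    using assms unfolding poly_degree_le_def by (auto simp: inner_axis fun_eq_iff)
  show ?thesis
    unfolding P
    by (intro poly_deg_sum poly_deg_cmult)
       (rule poly_deg_mono, rule poly_deg_prod[OF finite poly_deg_power], simp)
qed

lemma poly_deg_if_real_polynomial_function:
  fixes P :: "'a::euclidean_space \<Rightarrow> real"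
  assumes "real_polynomial_function P" shows "\<exists>d. poly_deg d P"
  using assms
proof (induction rule: real_polynomial_function.induct)
  case (linear f)
  then interpret bounded_linear f .
  have "f = (\<lambda>x. \<Sum>b\<in>Basis. f b * (x \<bullet> b))"
  proof
    fix x
    have "f x = f (\<Sum>b\<in>Basis. (x \<bullet> b) *\<^sub>R b)" by (simp add: euclidean_representation)
    also have "\<dots> = (\<Sum>b\<in>Basis. f b * (x \<bullet> b))" by (simp add: sum scaleR mult.commute)
    finally show "f x = (\<Sum>b\<in>Basis. f b * (x \<bullet> b))" .
  qed
  moreover have "poly_deg (Suc 0) (\<lambda>x. \<Sum>b\<in>Basis. f b * (x \<bullet> b))"
    by (intro poly_deg_sum poly_deg_cmult poly_deg_inner)
  ultimately show ?case by metis
next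
  case (add f g)
  then obtain d e where "poly_deg d f" "poly_deg e g" by blast
  then have "poly_deg (max d e) (\<lambda>x. f x + g x)"
    by (intro poly_deg.add) (auto intro: poly_deg_mono)
  then show ?case ..
qed (auto intro: poly_deg.const poly_deg_mult)

section \<open>Affine substitutions, and Fubini for averages of translates\<close>

lemma integral_lborel_affine:
  fixes f :: "'a::euclidean_space \<Rightarrow> 'b::{banach, second_countable_topology}"
  assumes [measurable]: "f \<in> borel_measurable borel" and "c \<noteq> 0"
  shows "integral\<^sup>L lborel f = \<bar>c\<bar> ^ DIM('a) *\<^sub>R (\<integral>x. f (t + c *\<^sub>R x) \<partial>lborel)"
proof -
  have "integral\<^sup>L lborel f = integral\<^sup>L (density (distr lborel borel (\<lambda>x. t + c *\<^sub>R x)) (\<lambda>_. \<bar>c\<bar> ^ DIM('a))) f"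
    using lborel_affine[OF assms(2), of t] by (rule arg_cong)
  also have "\<dots> = \<bar>c\<bar> ^ DIM('a) *\<^sub>R (\<integral>x. f (t + c *\<^sub>R x) \<partial>lborel)"
    by (simp add: integral_density integral_distr)
  finally show ?thesis .
qed

lemma integral_lborel_translate:
  fixes f :: "'a::euclidean_space \<Rightarrow> 'b::{banach, second_countable_topology}"
  assumes "f \<in> borel_measurable borel"
  shows "(\<integral>x. f (x + a) \<partial>lborel) = integral\<^sup>L lborel f"
  using integral_lborel_affine[OF assms, of 1 a] by (simp add: add.commute)

lemma integrable_lborel_bounded_support:
  fixes f :: "'a::euclidean_space \<Rightarrow> 'b::{banach, second_countable_topology}"
  assumes "f \<in> borel_measurable borel" "\<And>x. norm (f x) \<le> B" "\<And>x. norm x > R \<Longrightarrow> f x = 0"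
  shows "integrable lborel f"
  by (rule integrableI_bounded_set[where A = "cball 0 R" and B = B])
     (use assms emeasure_lborel_cball_finite[of 0 R] in auto)

text \<open>The support condition is imposed for s in [0, 1] only, where \<open>unif\<close> lives.
  Translates G(x + s v) of a compactly supported G therefore qualify, with the radius enlarged by
  the norm of v.\<close>

lemma Fubini_unif_lborel:
  fixes f :: "real \<Rightarrow> 'a::euclidean_space \<Rightarrow> 'b::{banach, second_countable_topology}"
  assumes f [measurable]: "case_prod f \<in> borel_measurable (borel \<Otimes>\<^sub>M borel)"
    and B: "\<And>s x. norm (f s x) \<le> B" and R: "\<And>s x. s \<in> {0..1} \<Longrightarrow> norm x > R \<Longrightarrow> f s x = 0"
  shows "(\<integral>s. \<integral>x. f s x \<partial>lborel \<partial>unif) = (\<integral>x. \<integral>s. f s x \<partial>unif \<partial>lborel)"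
    and "integrable lborel (\<lambda>x. \<integral>s. f s x \<partial>unif)"
    and "integrable unif (\<lambda>s. \<integral>x. f s x \<partial>lborel)"
proof -
  interpret pair_sigma_finite unif "lborel :: 'a measure" ..
  have ae: "AE z in unif \<Otimes>\<^sub>M (lborel :: 'a measure). fst z \<in> {0..1}"
  proof (rule AE_pair_measure)
    show "{z \<in> space (unif \<Otimes>\<^sub>M (lborel :: 'a measure)). fst z \<in> {0..1}} \<in> sets (unif \<Otimes>\<^sub>M lborel)"
      by measurable
    show "AE s in unif. AE x in (lborel :: 'a measure). fst (s, x) \<in> {0..1}"
      using AE_unif by eventually_elim simp
  qed
  have R': "norm x \<le> R" if "s \<in> {0..1}" "f s x \<noteq> 0" for s x
    using R[OF that(1)] that(2) by (meson not_le)
  have int: "integrable (unif \<Otimes>\<^sub>M lborel) (case_prod f)"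
  proof (rule integrableI_bounded_set)
    show "(UNIV \<times> cball 0 R :: (real \<times> 'a) set) \<in> sets (unif \<Otimes>\<^sub>M lborel)" by auto
    show "emeasure (unif \<Otimes>\<^sub>M lborel) (UNIV \<times> cball 0 R :: (real \<times> 'a) set) < \<infinity>"
      using emeasure_lborel_cball_finite[of "0 :: 'a" R]
      by (subst lborel.emeasure_pair_measure_Times) (auto simp: unif.emeasure_eq_measure)
    show "AE z in unif \<Otimes>\<^sub>M lborel. z \<in> UNIV \<times> cball 0 R \<longrightarrow> norm (case_prod f z) \<le> B"
      using B by auto
    show "AE z in unif \<Otimes>\<^sub>M lborel. z \<notin> UNIV \<times> cball 0 R \<longrightarrow> case_prod f z = 0"
      using ae by eventually_elim (use R' in auto)
  qed simp
  show "(\<integral>s. \<integral>x. f s x \<partial>lborel \<partial>unif) = (\<integral>x. \<integral>s. f s x \<partial>unif \<partial>lborel)"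
    by (rule Fubini_integral[OF int, symmetric])
  show "integrable lborel (\<lambda>x. \<integral>s. f s x \<partial>unif)" by (rule integrable_snd[OF int])
  show "integrable unif (\<lambda>s. \<integral>x. f s x \<partial>lborel)" by (rule integrable_fst[OF int])
qed

text \<open>
  The sublevel estimate on \<open>[0, 1]\<close> is applied along the segments from \<open>x\<^sub>0 + v / 2\<close> to
  \<open>x\<^sub>0 + v\<close>: averaging the dilations \<open>v \<mapsto> x\<^sub>0 + (1 + s) / 2 * v\<close> over \<open>s\<close> reduces the claim to
  them, and the corresponding one-variable polynomial takes the value \<open>S x\<^sub>0\<close> at \<open>s = -1\<close>.
\<close>

lemma integral_cball_poly_powr:
  fixes R \<rho> :: real
  assumes "1 \<le> d" "0 < \<epsilon>"
  obtains C \<epsilon>' where "0 \<le> C" "0 < \<epsilon>'"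
    "\<And>S (x\<^sub>0 :: 'a::euclidean_space). poly_deg d S \<Longrightarrow> norm x\<^sub>0 \<le> \<rho> \<Longrightarrow>
       (\<integral>x. indicator (cball 0 R) x * max 1 \<bar>S x\<bar> powr (- \<epsilon>) \<partial>lborel) \<le> C * max 1 \<bar>S x\<^sub>0\<bar> powr (- \<epsilon>')"
proof -
  obtain C\<^sub>1 \<epsilon>' where C1: "0 \<le> C\<^sub>1" "0 < \<epsilon>'" "\<And>p. degree p \<le> d \<Longrightarrow>
       (\<integral>s. max 1 \<bar>poly p s\<bar> powr (- \<epsilon>) \<partial>unif) \<le> C\<^sub>1 * max 1 (coeff_norm p) powr (- \<epsilon>')"
    using integral_unif_poly_powr[OF assms] by blast
  \<comment> \<open>If x0 + r v lies in the ball of radius R and r \<ge> 1/2, then the norm of v is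
    at most (R + \<rho>) / r, hence at most this.\<close>
  define R' where "R' = 2 * (R + \<rho>)"
  define K :: "'a set" where "K = cball 0 R'"
  define C where "C = measure lborel K * C\<^sub>1"
  have K [measurable]: "K \<in> sets borel" and Kfin: "emeasure lborel K < \<infinity>"
    using emeasure_lborel_cball_finite[of 0 R'] by (auto simp: K_def)
  have "(\<integral>x. indicator (cball 0 R) x * max 1 \<bar>S x\<bar> powr (- \<epsilon>) \<partial>lborel) \<le> C * max 1 \<bar>S x\<^sub>0\<bar> powr (- \<epsilon>')"
    if S: "poly_deg d S" and x0: "norm x\<^sub>0 \<le> \<rho>" for S :: "'a \<Rightarrow> real" and x\<^sub>0
  proof -
    define \<phi> where "\<phi> x = max 1 \<bar>S x\<bar> powr (- \<epsilon>)" for x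
    have \<phi>: "0 \<le> \<phi> x" "\<phi> x \<le> 1" for x using assms by (auto simp: \<phi>_def max_1_powr_le_1)
    have [measurable]: "S \<in> borel_measurable borel" by (rule poly_deg_measurable[OF S])
    have [measurable]: "\<phi> \<in> borel_measurable borel" unfolding \<phi>_def by measurable
    have "cball 0 R \<in> sets (borel :: 'a measure)" by simp
    then have m: "(\<lambda>x::'a. indicator (cball 0 R) x * \<phi> x) \<in> borel_measurable borel" by measurable
    define I where "I = (\<integral>x. indicator (cball 0 R) x * \<phi> x \<partial>lborel)"
    define f where "f s v = indicator K v * \<phi> (x\<^sub>0 + ((1 + s) / 2) *\<^sub>R v)" for s v
    have fm [measurable]: "case_prod f \<in> borel_measurable (borel \<Otimes>\<^sub>M borel)"
      unfolding f_def by measurable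
    have f1: "0 \<le> f s v" "f s v \<le> 1" "norm (f s v) \<le> 1" for s v
      using \<phi> by (auto simp: f_def indicator_def)
    have f0: "f s v = 0" if "norm v > R'" for s v using that by (simp add: f_def K_def)
    note fub = Fubini_unif_lborel[where f = f and B = 1 and R = R', OF fm f1(3) f0]
    have I: "I \<le> (\<integral>v. f s v \<partial>lborel)" if s: "s \<in> {0..1}" for s
    proof -
      define r where "r = (1 + s) / 2"
      have r: "1 / 2 \<le> r" "r \<le> 1" using s by (auto simp: r_def)
      have [measurable]: "f s \<in> borel_measurable borel" unfolding f_def by measurable
      have le: "indicator (cball 0 R) (x\<^sub>0 + r *\<^sub>R v) * \<phi> (x\<^sub>0 + r *\<^sub>R v) \<le> f s v" for v
      proof (cases "norm (x\<^sub>0 + r *\<^sub>R v) \<le> R")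
        case True
        have "norm (r *\<^sub>R v) \<le> norm (x\<^sub>0 + r *\<^sub>R v) + norm x\<^sub>0"
          using norm_triangle_ineq4[of "x\<^sub>0 + r *\<^sub>R v" x\<^sub>0] by simp
        also have "\<dots> \<le> R + \<rho>" using True x0 by linarith
        finally have "r * norm v \<le> R + \<rho>" using r by simp
        moreover have "(1 / 2) * norm v \<le> r * norm v" using r by (intro mult_right_mono) auto
        ultimately have "v \<in> K" by (simp add: K_def R'_def)
        then show ?thesis using True \<phi> by (simp add: f_def r_def)
      qed (use f1 in simp)
      have int: "integrable lborel (f s)"
        by (rule integrable_lborel_bounded_support[OF _ f1(3) f0]) auto
      \<comment> \<open>Substitution x = x0 + r v. Its Jacobian is at most 1 because r \<le> 1, so
        one bound holds for every dilation and may be averaged over s.\<close>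
      have "I = r ^ DIM('a) * (\<integral>v. indicator (cball 0 R) (x\<^sub>0 + r *\<^sub>R v) * \<phi> (x\<^sub>0 + r *\<^sub>R v) \<partial>lborel)"
        unfolding I_def using r by (subst integral_lborel_affine[OF m, of r x\<^sub>0]) auto
      also have "\<dots> \<le> 1 * (\<integral>v. f s v \<partial>lborel)"
      proof (intro mult_mono)
        show "(\<integral>v. indicator (cball 0 R) (x\<^sub>0 + r *\<^sub>R v) * \<phi> (x\<^sub>0 + r *\<^sub>R v) \<partial>lborel) \<le> (\<integral>v. f s v \<partial>lborel)"
          using \<phi> by (intro Bochner_Integration.integral_mono' int le) (auto simp: f1)
      qed (use r \<phi> in \<open>auto intro!: power_le_one integral_nonneg_AE\<close>)
      finally show ?thesis by simp
    qed
    have "I = (\<integral>s. I \<partial>unif)" by simp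
    also have "\<dots> \<le> (\<integral>s. \<integral>v. f s v \<partial>lborel \<partial>unif)"
    proof (rule integral_mono_AE)
      show "AE s in unif. I \<le> (\<integral>v. f s v \<partial>lborel)" using AE_unif by eventually_elim (rule I)
    qed (use fub in auto)
    also have "\<dots> = (\<integral>v. \<integral>s. f s v \<partial>unif \<partial>lborel)" by (rule fub(1))
    also have "\<dots> \<le> (\<integral>v. indicator K v * (C\<^sub>1 * max 1 \<bar>S x\<^sub>0\<bar> powr (- \<epsilon>')) \<partial>lborel)"
    proof (rule integral_mono)
      show "integrable lborel (\<lambda>v. \<integral>s. f s v \<partial>unif)" by (rule fub(2))
      show "integrable lborel (\<lambda>v. indicator K v * (C\<^sub>1 * max 1 \<bar>S x\<^sub>0\<bar> powr (- \<epsilon>')))"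
        using Kfin by (intro integrable_mult_left) (auto simp: integrable_indicator_iff)
      fix v
      obtain p where p: "degree p \<le> d" "\<And>s. S ((x\<^sub>0 + (1 / 2) *\<^sub>R v) + s *\<^sub>R ((1 / 2) *\<^sub>R v)) = poly p s"
        using poly_deg_line[OF S] by blast
      have *: "x\<^sub>0 + ((1 + s) / 2) *\<^sub>R v = (x\<^sub>0 + (1 / 2) *\<^sub>R v) + s *\<^sub>R ((1 / 2) *\<^sub>R v)" for s
        by (simp add: add_divide_distrib scaleR_add_left)
      have "S x\<^sub>0 = poly p (- 1)" using p(2)[of "- 1"] by simp
      then have S0: "\<bar>S x\<^sub>0\<bar> \<le> coeff_norm p" using poly_le_coeff_norm[of "- 1" p] by simp
      have "(\<integral>s. f s v \<partial>unif) = indicator K v * (\<integral>s. max 1 \<bar>poly p s\<bar> powr (- \<epsilon>) \<partial>unif)"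
        unfolding f_def \<phi>_def * p(2) by simp
      also have "\<dots> \<le> indicator K v * (C\<^sub>1 * max 1 \<bar>S x\<^sub>0\<bar> powr (- \<epsilon>'))"
      proof (intro mult_left_mono order_trans[OF C1(3)[OF p(1)]])
        show "max 1 (coeff_norm p) powr (- \<epsilon>') \<le> max 1 \<bar>S x\<^sub>0\<bar> powr (- \<epsilon>')"
          using S0 C1 by (intro powr_mono2') auto
      qed (use C1 in auto)
      finally show "(\<integral>s. f s v \<partial>unif) \<le> indicator K v * (C\<^sub>1 * max 1 \<bar>S x\<^sub>0\<bar> powr (- \<epsilon>'))" .
    qed
    also have "\<dots> = C * max 1 \<bar>S x\<^sub>0\<bar> powr (- \<epsilon>')" by (simp add: C_def)
    finally show ?thesis by (simp add: I_def \<phi>_def)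
  qed
  moreover have "0 \<le> C" using C1 by (simp add: C_def)
  ultimately show thesis using C1(2) that by blast
qed

section \<open>Decay with invariant factors\<close>

text \<open>Only a sup bound, a Lipschitz constant and a support radius enter, which is why the
  final constant is linear in the C^1 norm. Products of a translate with a conjugate stay in the
  class: R is kept, and M becomes 2 max M 0.\<close>

definition amplitude :: "real \<Rightarrow> real \<Rightarrow> ('a::euclidean_space \<Rightarrow> complex) \<Rightarrow> bool" where
  "amplitude R M \<eta> \<longleftrightarrow> (\<forall>x. norm (\<eta> x) \<le> 1) \<and>
     (\<forall>x y. norm (\<eta> x - \<eta> y) \<le> M * norm (x - y)) \<and> (\<forall>x. norm x > R \<longrightarrow> \<eta> x = 0)"

text \<open>Models f_j o pi_j scaled to sup norm 1. All conditions hold everywhere rather than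
  almost everywhere, so the factor can be restricted to individual lines in direction v.\<close>

definition invariant_factor :: "'a::euclidean_space \<Rightarrow> ('a \<Rightarrow> complex) \<Rightarrow> bool" where
  "invariant_factor v F \<longleftrightarrow> F \<in> borel_measurable borel \<and> (\<forall>x. norm (F x) \<le> 1) \<and>
     (\<forall>x s. F (x + s *\<^sub>R v) = F x)"

definition osc_integrand ::
  "('a \<Rightarrow> real) \<Rightarrow> nat \<Rightarrow> (nat \<Rightarrow> 'a \<Rightarrow> complex) \<Rightarrow> ('a \<Rightarrow> complex) \<Rightarrow> 'a \<Rightarrow> complex" where
  "osc_integrand P n F \<eta> x = cis (P x) * (\<Prod>j=1..n. F j x) * \<eta> x"

text \<open>The constants precede P, F, \<eta> and the point, so the bound can be used for all phase
  differences at once with the same point. The maximum with 1 turns it into mere boundedness when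
  the derivative is small.\<close>

definition decay_bound ::
  "(nat \<Rightarrow> 'a::euclidean_space) \<Rightarrow> nat \<Rightarrow> nat \<Rightarrow> real \<Rightarrow> real \<Rightarrow> real \<Rightarrow> real \<Rightarrow> real \<Rightarrow> bool" where
  "decay_bound w n d R M \<rho> C \<epsilon> \<longleftrightarrow> 0 \<le> C \<and> 0 < \<epsilon> \<and>
     (\<forall>P F \<eta> x\<^sub>0. poly_deg d P \<longrightarrow> (\<forall>j\<in>{1..n}. invariant_factor (w j) (F j)) \<longrightarrow>
        amplitude R M \<eta> \<longrightarrow> norm x\<^sub>0 \<le> \<rho> \<longrightarrow>
        norm (integral\<^sup>L lborel (osc_integrand P n F \<eta>))
          \<le> C * max 1 \<bar>dir_deriv_prod w n P x\<^sub>0\<bar> powr (- \<epsilon>))"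

lemma decay_boundI:
  assumes "0 \<le> C" "0 < \<epsilon>"
    and "\<And>P F \<eta> x\<^sub>0. poly_deg d P \<Longrightarrow> \<forall>j\<in>{1..n}. invariant_factor (w j) (F j) \<Longrightarrow>
        amplitude R M \<eta> \<Longrightarrow> norm x\<^sub>0 \<le> \<rho> \<Longrightarrow>
        norm (integral\<^sup>L lborel (osc_integrand P n F \<eta>))
          \<le> C * max 1 \<bar>dir_deriv_prod w n P x\<^sub>0\<bar> powr (- \<epsilon>)"
  shows "decay_bound w n d R M \<rho> C \<epsilon>"
  unfolding decay_bound_def using assms by blast

lemma decay_boundD:
  assumes "decay_bound w n d R M \<rho> C \<epsilon>"
  shows "0 \<le> C" "0 < \<epsilon>"
    and "poly_deg d P \<Longrightarrow> \<forall>j\<in>{1..n}. invariant_factor (w j) (F j) \<Longrightarrow>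
        amplitude R M \<eta> \<Longrightarrow> norm x\<^sub>0 \<le> \<rho> \<Longrightarrow>
        norm (integral\<^sup>L lborel (osc_integrand P n F \<eta>))
          \<le> C * max 1 \<bar>dir_deriv_prod w n P x\<^sub>0\<bar> powr (- \<epsilon>)"
  using assms unfolding decay_bound_def by blast+

lemma amplitude_continuous:
  assumes "amplitude R M \<eta>" shows "continuous_on A \<eta>"
proof (rule lipschitz_on_continuous_on[of "max M 0"], rule lipschitz_onI)
  fix x y assume "x \<in> A" "y \<in> A"
  have "norm (\<eta> x - \<eta> y) \<le> M * norm (x - y)" using assms by (simp add: amplitude_def)
  also have "\<dots> \<le> max M 0 * norm (x - y)" by (intro mult_right_mono) auto
  finally show "dist (\<eta> x) (\<eta> y) \<le> max M 0 * dist x y" by (simp add: dist_norm)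
qed simp

lemma osc_integrand_measurable:
  assumes "poly_deg d P" "\<forall>j\<in>{1..n}. invariant_factor (w j) (F j)" "amplitude R M \<eta>"
  shows "osc_integrand P n F \<eta> \<in> borel_measurable borel"
proof -
  have [measurable]: "(\<lambda>x. cis (P x)) \<in> borel_measurable borel"
    by (intro borel_measurable_continuous_onI continuous_intros poly_deg_continuous_on[OF assms(1)])
  have [measurable]: "\<eta> \<in> borel_measurable borel"
    by (intro borel_measurable_continuous_onI amplitude_continuous[OF assms(3)])
  have [measurable]: "(\<lambda>x. \<Prod>j=1..n. F j x) \<in> borel_measurable borel"
    using assms(2) by (intro borel_measurable_prod) (auto simp: invariant_factor_def)
  show ?thesis unfolding osc_integrand_def by measurable
qed

lemma norm_osc_integrand_le_1:
  assumes "\<forall>j\<in>{1..n}. invariant_factor (w j) (F j)" "amplitude R M \<eta>"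
  shows "norm (osc_integrand P n F \<eta> x) \<le> 1"
proof -
  have "norm (\<Prod>j=1..n. F j x) \<le> 1"
    unfolding prod_norm[symmetric] using assms(1) by (intro prod_le_1) (auto simp: invariant_factor_def)
  then have "norm (\<Prod>j=1..n. F j x) * norm (\<eta> x) \<le> 1 * 1"
    using assms(2) by (intro mult_mono) (auto simp: amplitude_def)
  then show ?thesis by (simp add: osc_integrand_def norm_mult)
qed

lemma osc_integrand_eq_0: "amplitude R M \<eta> \<Longrightarrow> norm x > R \<Longrightarrow> osc_integrand P n F \<eta> x = 0"
  by (simp add: osc_integrand_def amplitude_def)

lemma norm_add_scaleR_gt:
  fixes x v :: "'a::real_normed_vector"
  assumes "norm x > R + norm v" "\<bar>t\<bar> \<le> 1" shows "norm (x + t *\<^sub>R v) > R"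
proof -
  have "norm x \<le> norm (x + t *\<^sub>R v) + norm (t *\<^sub>R v)"
    using norm_triangle_ineq4[of "x + t *\<^sub>R v" "t *\<^sub>R v"] by simp
  moreover have "norm (t *\<^sub>R v) \<le> norm v"
    using assms(2) mult_right_mono[of "\<bar>t\<bar>" 1 "norm v"] by simp
  ultimately show ?thesis using assms(1) by linarith
qed

text \<open>
  Averaging over the translations \<open>x \<mapsto> x + s * h * w\<close>, \<open>0 \<le> s \<le> 1\<close>, leaves the factor
  unchanged and the amplitude almost unchanged, so that the van der Corput estimate applies on
  every such segment. The scale \<open>h\<close> balances the two errors.
\<close>

lemma decay_bound_1:
  fixes w :: "nat \<Rightarrow> 'a::euclidean_space"
  shows "\<exists>C \<epsilon>. decay_bound w 1 d R M \<rho> C \<epsilon>"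
proof -
  define v where "v = w 1"
  \<comment> \<open>The one-variable estimates want a degree bound of at least 1;
    \<open>Suc d\<close> covers d = 0.\<close>
  obtain C\<^sub>1 a where C1: "0 \<le> C\<^sub>1" "0 < a" "\<And>q. degree q \<le> Suc d \<Longrightarrow>
       norm (\<integral>s. cis (poly q s) \<partial>unif) \<le> C\<^sub>1 * max 1 (coeff_norm (pderiv q)) powr (- a)"
    using van_der_Corput_poly[of "Suc d"] by auto
  obtain C\<^sub>2 b where C2: "0 \<le> C\<^sub>2" "0 < b" "\<And>S (x\<^sub>0 :: 'a). poly_deg (Suc d) S \<Longrightarrow> norm x\<^sub>0 \<le> \<rho> \<Longrightarrow>
       (\<integral>x. indicator (cball 0 R) x * max 1 \<bar>S x\<bar> powr (- a) \<partial>lborel) \<le> C\<^sub>2 * max 1 \<bar>S x\<^sub>0\<bar> powr (- b)"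
    by (rule integral_cball_poly_powr[where 'a = 'a and d = "Suc d" and \<epsilon> = a and R = R and \<rho> = \<rho>])
       (simp, rule C1(2), blast)
  define K :: "'a set" where "K = cball 0 (R + norm v)"
  define C\<^sub>3 where "C\<^sub>3 = max M 0 * norm v * measure lborel K"
  define \<epsilon> where "\<epsilon> = min (1 / 2) (b / 2)"
  have K [measurable]: "K \<in> sets borel" and Kfin: "emeasure lborel K < \<infinity>"
    using emeasure_lborel_cball_finite[of "0::'a" "R + norm v"] by (auto simp: K_def)
  have C3: "0 \<le> C\<^sub>3" by (simp add: C\<^sub>3_def)
  have "norm (integral\<^sup>L lborel (osc_integrand P 1 F \<eta>)) \<le> (C\<^sub>3 + C\<^sub>1 * C\<^sub>2) * max 1 \<bar>dir_deriv_prod w 1 P x\<^sub>0\<bar> powr (- \<epsilon>)"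
    if P: "poly_deg d P" and F: "\<forall>j\<in>{1..1}. invariant_factor (w j) (F j)"
      and \<eta>: "amplitude R M \<eta>" and x0: "norm x\<^sub>0 \<le> \<rho>" for P F \<eta> x\<^sub>0
  proof -
    define S where "S = dir_deriv v P"
    define A where "A = max 1 \<bar>S x\<^sub>0\<bar>"
    \<comment> \<open>Freezing the amplitude over a segment of length proportional to h costs O(h),
      that is A powr (- 1/2), while the rescaled derivative h S still has size A powr (1/2) at the
      given point when |S| exceeds 1 there.\<close>
    define h where "h = A powr (- (1 / 2))"
    have A: "1 \<le> A" by (simp add: A_def)
    have h: "0 < h" "h \<le> 1" using A by (auto simp: h_def intro!: order_trans[OF powr_mono[of "- (1/2)" 0]])
    have Pl: "poly_deg (Suc d) P" by (rule poly_deg.lift[OF P])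
    have Sl: "poly_deg (Suc d) (\<lambda>x. h * S x)"
      unfolding S_def by (intro poly_deg_cmult poly_deg_dir_deriv Pl)
    define G where "G = osc_integrand P 1 F \<eta>"
    define \<Lambda> where "\<Lambda> = integral\<^sup>L lborel G"
    have Gm [measurable]: "G \<in> borel_measurable borel"
      unfolding G_def by (rule osc_integrand_measurable[OF P F \<eta>])
    have G1: "norm (G x) \<le> 1" and G0: "norm x > R \<Longrightarrow> G x = 0" for x
      unfolding G_def by (rule norm_osc_integrand_le_1[OF F \<eta>], rule osc_integrand_eq_0[OF \<eta>])
    have Fm [measurable]: "F 1 \<in> borel_measurable borel" and F1: "norm (F 1 x) \<le> 1"
      and Finv: "F 1 (x + s *\<^sub>R v) = F 1 x" for x s
      using F by (auto simp: invariant_factor_def v_def)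
    have \<eta>m [measurable]: "\<eta> \<in> borel_measurable borel"
      by (intro borel_measurable_continuous_onI amplitude_continuous[OF \<eta>])
    have \<eta>1: "norm (\<eta> x) \<le> 1" and \<eta>L: "norm (\<eta> x - \<eta> y) \<le> M * norm (x - y)"
      and \<eta>0: "norm x > R \<Longrightarrow> \<eta> x = 0" for x y
      using \<eta> by (auto simp: amplitude_def)
    have [measurable]: "(\<lambda>x. cis (P x)) \<in> borel_measurable borel"
      by (intro borel_measurable_continuous_onI continuous_intros poly_deg_continuous_on[OF P])
    \<comment> \<open>Only the phase is translated. The factor \<open>F 1\<close> does not notice
      the translation, and replacing the translated amplitude by \<eta> x is the error paid for by
      the Lipschitz bound.\<close>
    define f where "f s x = F 1 x * \<eta> x * cis (P (x + s *\<^sub>R (h *\<^sub>R v)))" for s x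
    have fm [measurable]: "case_prod f \<in> borel_measurable (borel \<Otimes>\<^sub>M borel)"
      unfolding f_def by measurable
    have f1: "norm (f s x) \<le> 1" for s x
      using mult_mono[OF F1[of x] \<eta>1[of x]] by (simp add: f_def norm_mult)
    have f0: "f s x = 0" if "norm x > R" for s x
      using \<eta>0[OF that] by (simp add: f_def)
    note fub = Fubini_unif_lborel[where f = f and B = 1 and R = R, OF fm f1 f0]
    have "norm (\<Lambda> - (\<integral>x. f s x \<partial>lborel)) \<le> C\<^sub>3 * h" if s: "s \<in> {0..1}" for s
    proof -
      have [measurable]: "f s \<in> borel_measurable borel" unfolding f_def by measurable
      have sh: "\<bar>s * h\<bar> \<le> 1" "\<bar>s * h\<bar> \<le> h" using s h mult_mono[of s 1 h 1] mult_right_mono[of s 1 h] by (auto simp: abs_mult)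
      have far: "norm (x + (s * h) *\<^sub>R v) > R" "norm x > R" if "x \<notin> K" for x
        using norm_add_scaleR_gt[of R v x "s * h"] norm_add_scaleR_gt[of R v x 0] that sh by (auto simp: K_def)
      have "\<Lambda> = (\<integral>x. G (x + (s * h) *\<^sub>R v) \<partial>lborel)"
        unfolding \<Lambda>_def by (rule integral_lborel_translate[symmetric]) simp
      moreover have "integrable lborel (\<lambda>x. G (x + (s * h) *\<^sub>R v))"
        by (rule integrable_lborel_bounded_support[where B = 1 and R = "R + norm v"])
           (use G1 G0 far in \<open>auto simp: K_def\<close>)
      moreover have "integrable lborel (f s)"
        by (rule integrable_lborel_bounded_support[OF _ f1 f0]) auto
      ultimately have "\<Lambda> - (\<integral>x. f s x \<partial>lborel) = (\<integral>x. G (x + (s * h) *\<^sub>R v) - f s x \<partial>lborel)" by simp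
      also have "norm \<dots> \<le> (\<integral>x. indicator K x * (max M 0 * (h * norm v)) \<partial>lborel)"
      proof (rule Bochner_Integration.integral_norm_bound_integral)
        show "integrable lborel (\<lambda>x. G (x + (s * h) *\<^sub>R v) - f s x)" by (intro Bochner_Integration.integrable_diff; fact)
        show "integrable lborel (\<lambda>x. indicator K x * (max M 0 * (h * norm v)))"
          using Kfin by (intro integrable_mult_left) (auto simp: integrable_indicator_iff)
        fix x
        have "G (x + (s * h) *\<^sub>R v) - f s x
            = cis (P (x + (s * h) *\<^sub>R v)) * F 1 x * (\<eta> (x + (s * h) *\<^sub>R v) - \<eta> x)"
          using Finv[of x "s * h"] by (simp add: G_def osc_integrand_def f_def algebra_simps)
        then have "norm (G (x + (s * h) *\<^sub>R v) - f s x) = norm (F 1 x) * norm (\<eta> (x + (s * h) *\<^sub>R v) - \<eta> x)"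
          by (simp add: norm_mult)
        also have "\<dots> \<le> 1 * (indicator K x * (max M 0 * (h * norm v)))"
        proof (rule mult_mono[OF F1])
          show "norm (\<eta> (x + (s * h) *\<^sub>R v) - \<eta> x) \<le> indicator K x * (max M 0 * (h * norm v))"
          proof (cases "x \<in> K")
            case True
            have "norm (\<eta> (x + (s * h) *\<^sub>R v) - \<eta> x) \<le> M * (\<bar>s * h\<bar> * norm v)"
              using \<eta>L[of "x + (s * h) *\<^sub>R v" x] by simp
            also have "\<dots> \<le> max M 0 * (h * norm v)"
              using h by (intro mult_mono mult_right_mono sh(2)) auto
            finally show ?thesis using True by simp
          qed (use far \<eta>0 in simp)
        qed auto
        finally show "norm (G (x + (s * h) *\<^sub>R v) - f s x) \<le> indicator K x * (max M 0 * (h * norm v))" by simp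
      qed
      also have "\<dots> = C\<^sub>3 * h" by (simp add: C\<^sub>3_def)
      finally show ?thesis .
    qed
    then have "norm (\<integral>s. \<Lambda> - (\<integral>x. f s x \<partial>lborel) \<partial>unif) \<le> C\<^sub>3 * h"
      by (intro norm_integral_unif_le_const) (use borel_measurable_integrable[OF fub(3)] in auto)
    also have "(\<integral>s. \<Lambda> - (\<integral>x. f s x \<partial>lborel) \<partial>unif) = \<Lambda> - (\<integral>x. \<integral>s. f s x \<partial>unif \<partial>lborel)"
      using fub(1,3) by simp
    finally have 1: "norm (\<Lambda> - (\<integral>x. \<integral>s. f s x \<partial>unif \<partial>lborel)) \<le> C\<^sub>3 * h" .
    \<comment> \<open>The van der Corput estimate in s gains a power of the derivative h S x at each
      x, which may vanish at some x. Averaging over the ball by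
      \<open>integral_cball_poly_powr\<close> converts this into a power of its value at the single
      given point.\<close>
    have "norm (\<integral>x. \<integral>s. f s x \<partial>unif \<partial>lborel)
        \<le> (\<integral>x. C\<^sub>1 * (indicator (cball 0 R) x * max 1 \<bar>h * S x\<bar> powr (- a)) \<partial>lborel)"
    proof (rule Bochner_Integration.integral_norm_bound_integral[OF fub(2)])
      have [measurable]: "(\<lambda>x. h * S x) \<in> borel_measurable borel" by (rule poly_deg_measurable[OF Sl])
      have [measurable]: "cball 0 R \<in> sets (borel :: 'a measure)" by simp
      show "integrable lborel (\<lambda>x. C\<^sub>1 * (indicator (cball 0 R) x * max 1 \<bar>h * S x\<bar> powr (- a)))"
        by (intro integrable_mult_right integrable_lborel_bounded_support[where B = 1 and R = R])
           (use max_1_powr_le_1 C1 in \<open>auto simp: indicator_def\<close>)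
      fix x
      obtain q where q: "degree q \<le> Suc d" "\<And>s. P (x + s *\<^sub>R (h *\<^sub>R v)) = poly q s"
        using poly_deg_line[OF Pl] by blast
      have "poly (pderiv q) 0 = dir_deriv (h *\<^sub>R v) P x"
        using poly_pderiv_line[OF P q(2), of 0] by simp
      also have "\<dots> = h * S x"
        using linear_cmul[OF has_derivative_linear[OF poly_deg_has_derivative[OF P]], of h v x]
        by (simp add: S_def)
      finally have hS: "\<bar>h * S x\<bar> \<le> coeff_norm (pderiv q)"
        using poly_le_coeff_norm[of 0 "pderiv q"] by simp
      have "(\<integral>s. f s x \<partial>unif) = F 1 x * \<eta> x * (\<integral>s. cis (poly q s) \<partial>unif)"
        unfolding f_def q(2) by simp
      then have "norm (\<integral>s. f s x \<partial>unif) = norm (F 1 x) * norm (\<eta> x) * norm (\<integral>s. cis (poly q s) \<partial>unif)"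
        by (simp add: norm_mult)
      also have "\<dots> \<le> 1 * indicator (cball 0 R) x * (C\<^sub>1 * max 1 \<bar>h * S x\<bar> powr (- a))"
      proof (intro mult_mono F1)
        show "norm (\<eta> x) \<le> indicator (cball 0 R) x" using \<eta>1 \<eta>0 by (auto simp: indicator_def)
        have "max 1 (coeff_norm (pderiv q)) powr (- a) \<le> max 1 \<bar>h * S x\<bar> powr (- a)"
          using hS C1 by (intro powr_mono2') auto
        then show "norm (\<integral>s. cis (poly q s) \<partial>unif) \<le> C\<^sub>1 * max 1 \<bar>h * S x\<bar> powr (- a)"
          by (intro order_trans[OF C1(3)[OF q(1)]] mult_left_mono C1)
      qed auto
      finally show "norm (\<integral>s. f s x \<partial>unif) \<le> C\<^sub>1 * (indicator (cball 0 R) x * max 1 \<bar>h * S x\<bar> powr (- a))"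
        by (simp add: mult_ac)
    qed
    also have "\<dots> \<le> C\<^sub>1 * (C\<^sub>2 * max 1 \<bar>h * S x\<^sub>0\<bar> powr (- b))"
      using C2(3)[OF Sl x0] C1(1) by (simp add: mult_left_mono)
    also have "max 1 \<bar>h * S x\<^sub>0\<bar> powr (- b) \<le> A powr (- (b / 2))"
    proof -
      have "A powr (1 / 2) \<le> max 1 \<bar>h * S x\<^sub>0\<bar>"
      proof (cases "\<bar>S x\<^sub>0\<bar> \<le> 1")
        case False
        then have "\<bar>h * S x\<^sub>0\<bar> = h * A powr 1" using h by (simp add: A_def abs_mult)
        also have "\<dots> = A powr (1 / 2)" unfolding h_def powr_add[symmetric] by simp
        finally show ?thesis by simp
      qed (simp add: A_def)
      then have "max 1 \<bar>h * S x\<^sub>0\<bar> powr (- b) \<le> (A powr (1 / 2)) powr (- b)"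
        using C2 A by (intro powr_mono2') auto
      then show ?thesis by (simp add: powr_powr)
    qed
    finally have 2: "norm (\<integral>x. \<integral>s. f s x \<partial>unif \<partial>lborel) \<le> C\<^sub>1 * (C\<^sub>2 * A powr (- (b / 2)))"
      using C1(1) C2(1) by (simp add: mult_left_mono)
    have "norm \<Lambda> \<le> norm (\<Lambda> - (\<integral>x. \<integral>s. f s x \<partial>unif \<partial>lborel)) + norm (\<integral>x. \<integral>s. f s x \<partial>unif \<partial>lborel)"
      using norm_triangle_ineq[of "\<Lambda> - (\<integral>x. \<integral>s. f s x \<partial>unif \<partial>lborel)" "\<integral>x. \<integral>s. f s x \<partial>unif \<partial>lborel"] by simp
    also have "\<dots> \<le> C\<^sub>3 * A powr (- (1 / 2)) + C\<^sub>1 * C\<^sub>2 * A powr (- (b / 2))"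
      using 1 2 by (simp add: h_def)
    also have "\<dots> \<le> C\<^sub>3 * A powr (- \<epsilon>) + C\<^sub>1 * C\<^sub>2 * A powr (- \<epsilon>)"
      using A C1 C2 C3 by (intro add_mono mult_left_mono powr_mono) (auto simp: \<epsilon>_def)
    finally show ?thesis by (simp add: \<Lambda>_def G_def A_def S_def v_def distrib_right)
  qed
  moreover have "0 \<le> C\<^sub>3 + C\<^sub>1 * C\<^sub>2" "0 < \<epsilon>" using C1 C2 C3 by (auto simp: \<epsilon>_def)
  ultimately show ?thesis by (intro exI decay_boundI)
qed

lemma borel_measurable_cnj [measurable]: "cnj \<in> borel_measurable borel"
  by (intro borel_measurable_continuous_onI continuous_intros)

text \<open>With G the integrand stripped of its last factor and H its average along v, the form is
  the integral of the last factor times H, so only the size of H matters. Its square integral is a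
  double average of correlations of two translates of G, and each correlation is an oscillatory
  integral with n factors. The hypothesis is needed for every M because the correlated amplitude has
  a larger Lipschitz constant.\<close>

lemma decay_bound_Suc:
  fixes w :: "nat \<Rightarrow> 'a::euclidean_space"
  assumes "\<And>M. \<exists>C \<epsilon>. decay_bound w n d R M \<rho> C \<epsilon>"
  shows "\<exists>C \<epsilon>. decay_bound w (Suc n) d R M \<rho> C \<epsilon>"
proof -
  define v where "v = w (Suc n)"
  obtain C\<^sub>1 a where "decay_bound w n d R (2 * max M 0) \<rho> C\<^sub>1 a" using assms by blast
  note C1 = decay_boundD[OF this]
  obtain C\<^sub>2 b where C2: "0 \<le> C\<^sub>2" "0 < b" "\<And>p. degree p \<le> Suc d \<Longrightarrow>
       (\<integral>s. max 1 \<bar>poly p s\<bar> powr (- a) \<partial>unif) \<le> C\<^sub>2 * max 1 (coeff_norm p) powr (- b)"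
    using integral_unif_poly_powr[OF _ C1(2), of "Suc d"] by auto
  define K :: "'a set" where "K = cball 0 (R + norm v)"
  define C\<^sub>3 where "C\<^sub>3 = C\<^sub>1 * (C\<^sub>2 * real (Suc d) powr b)"
  have K [measurable]: "K \<in> sets borel" and Kfin: "emeasure lborel K < \<infinity>"
    using emeasure_lborel_cball_finite[of "0::'a" "R + norm v"] by (auto simp: K_def)
  have C3: "0 \<le> C\<^sub>3" using C1 C2 by (simp add: C\<^sub>3_def)
  have "norm (integral\<^sup>L lborel (osc_integrand P (Suc n) F \<eta>))
      \<le> (measure lborel K + C\<^sub>3) * max 1 \<bar>dir_deriv_prod w (Suc n) P x\<^sub>0\<bar> powr (- (b / 2))"
    if P: "poly_deg d P" and F: "\<forall>j\<in>{1..Suc n}. invariant_factor (w j) (F j)"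
      and \<eta>: "amplitude R M \<eta>" and x0: "norm x\<^sub>0 \<le> \<rho>" for P F \<eta> x\<^sub>0
  proof -
    define S where "S = dir_deriv_prod w n P"
    define A where "A = max 1 \<bar>dir_deriv v S x\<^sub>0\<bar>"
    have A: "1 \<le> A" by (simp add: A_def)
    have S: "poly_deg d S" unfolding S_def by (rule poly_deg_dir_deriv_prod[OF P])
    have Fn: "\<forall>j\<in>{1..n}. invariant_factor (w j) (F j)" using F by simp
    define G where "G = osc_integrand P n F \<eta>"
    define F' where "F' = F (Suc n)"
    have Gm [measurable]: "G \<in> borel_measurable borel"
      unfolding G_def by (rule osc_integrand_measurable[OF P Fn \<eta>])
    have G1: "norm (G x) \<le> 1" and G0: "norm x > R \<Longrightarrow> G x = 0" for x
      unfolding G_def by (rule norm_osc_integrand_le_1[OF Fn \<eta>], rule osc_integrand_eq_0[OF \<eta>])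
    have Fm [measurable]: "F' \<in> borel_measurable borel" and F1: "norm (F' x) \<le> 1"
      and Finv: "F' (x + s *\<^sub>R v) = F' x" for x s
      using F by (auto simp: invariant_factor_def v_def F'_def)
    have GK: "G (x + s *\<^sub>R v) = 0" if "s \<in> {0..1}" "norm x > R + norm v" for x s
      using G0 norm_add_scaleR_gt[of R v x s] that by auto
    define H where "H x = (\<integral>s. G (x + s *\<^sub>R v) \<partial>unif)" for x
    define \<Lambda> where "\<Lambda> = (\<integral>x. F' x * G x \<partial>lborel)"
    have m1: "(\<lambda>(s, x). F' x * G (x + s *\<^sub>R v)) \<in> borel_measurable (borel \<Otimes>\<^sub>M borel)"
      "(\<lambda>(s, x). G (x + s *\<^sub>R v)) \<in> borel_measurable (borel \<Otimes>\<^sub>M borel)" by measurable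
    note fub1 = Fubini_unif_lborel[where f = "\<lambda>s x. F' x * G (x + s *\<^sub>R v)" and B = 1 and R = "R + norm v", OF m1(1)]
    note fub2 = Fubini_unif_lborel[where f = "\<lambda>s x. G (x + s *\<^sub>R v)" and B = 1 and R = "R + norm v", OF m1(2)]
    have [measurable]: "H \<in> borel_measurable borel"
      using borel_measurable_integrable[OF fub2(2)] G1 GK by (simp add: H_def[abs_def])
    have H1: "norm (H x) \<le> 1" for x
      unfolding H_def by (rule norm_integral_unif_le_const) (auto simp: G1)
    have H0: "H x = 0" if "norm x > R + norm v" for x
      using norm_integral_unif_le_const[of "\<lambda>s. G (x + s *\<^sub>R v)" 0] GK[OF _ that] by (auto simp: H_def)
    have intH: "integrable lborel (\<lambda>x. norm (H x))" "integrable lborel (\<lambda>x. (norm (H x))\<^sup>2)"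
      by (rule integrable_lborel_bounded_support[where B = 1 and R = "R + norm v"];
          use H1 H0 in \<open>auto intro: power_le_one\<close>)+
    have \<Lambda>: "norm \<Lambda> \<le> (\<integral>x. norm (H x) \<partial>lborel)"
    proof -
      have "\<Lambda> = (\<integral>x. F' x * G (x + s *\<^sub>R v) \<partial>lborel)" for s
        unfolding \<Lambda>_def using integral_lborel_translate[of "\<lambda>x. F' x * G x" "s *\<^sub>R v"] by (simp add: Finv)
      \<comment> \<open>The value is the same for every translate since \<open>F'\<close> is
        invariant along v; averaging over s therefore changes nothing on the left and produces H on
        the right.\<close>
      then have "\<Lambda> = (\<integral>s. \<integral>x. F' x * G (x + s *\<^sub>R v) \<partial>lborel \<partial>unif)" by simp
      also have "\<dots> = (\<integral>x. F' x * H x \<partial>lborel)"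
        using mult_le_one[OF F1 norm_ge_zero G1] GK by (subst fub1(1)) (auto simp: H_def norm_mult)
      finally have "norm \<Lambda> = norm (\<integral>x. F' x * H x \<partial>lborel)" by simp
      also have "\<dots> \<le> (\<integral>x. norm (H x) \<partial>lborel)"
      proof (rule Bochner_Integration.integral_norm_bound_integral[OF _ intH(1)])
        show "integrable lborel (\<lambda>x. F' x * H x)"
          by (rule integrable_lborel_bounded_support[where B = 1 and R = "R + norm v"])
             (use H0 mult_le_one[OF F1 norm_ge_zero H1] in \<open>auto simp: norm_mult\<close>)
        show "norm (F' x * H x) \<le> norm (H x)" for x
          using F1[of x] by (simp add: norm_mult mult_left_le_one_le)
      qed
      finally show ?thesis .
    qed
    \<comment> \<open>A correlation at shift t has phase P(x + t v) - P(x) and factors F_j(x + t v)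
      times the conjugate of F_j(x), which keep their invariance because translations commute. Its
      amplitude vanishes wherever \<eta> does, so R does not grow.\<close>
    have inner: "norm (\<integral>x. G (x + t *\<^sub>R v) * cnj (G x) \<partial>lborel)
        \<le> C\<^sub>1 * max 1 \<bar>S (x\<^sub>0 + t *\<^sub>R v) - S x\<^sub>0\<bar> powr (- a)" for t
    proof -
      define F\<^sub>t where "F\<^sub>t j x = F j (x + t *\<^sub>R v) * cnj (F j x)" for j x
      define \<eta>\<^sub>t where "\<eta>\<^sub>t x = \<eta> (x + t *\<^sub>R v) * cnj (\<eta> x)" for x
      have "G (x + t *\<^sub>R v) * cnj (G x) = osc_integrand (\<lambda>x. P (x + t *\<^sub>R v) - P x) n F\<^sub>t \<eta>\<^sub>t x" for x
        by (simp add: G_def osc_integrand_def F\<^sub>t_def \<eta>\<^sub>t_def prod.distrib cis_cnj cis_mult mult_ac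
              flip: cis_divide cis_inverse) (simp add: divide_inverse mult_ac)
      then have "(\<integral>x. G (x + t *\<^sub>R v) * cnj (G x) \<partial>lborel)
          = integral\<^sup>L lborel (osc_integrand (\<lambda>x. P (x + t *\<^sub>R v) - P x) n F\<^sub>t \<eta>\<^sub>t)" by simp
      also have "norm \<dots> \<le> C\<^sub>1 * max 1 \<bar>dir_deriv_prod w n (\<lambda>x. P (x + t *\<^sub>R v) - P x) x\<^sub>0\<bar> powr (- a)"
      proof (rule C1(3)[OF poly_deg_diff[OF poly_deg_translate[OF P] P] _ _ x0])
        show "\<forall>j\<in>{1..n}. invariant_factor (w j) (F\<^sub>t j)"
        proof
          fix j assume j: "j \<in> {1..n}"
          have [measurable]: "F j \<in> borel_measurable borel" and 1: "norm (F j x) \<le> 1"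
            and inv: "F j (x + s *\<^sub>R w j) = F j x" for x s
            using Fn j by (auto simp: invariant_factor_def)
          have "F j (x + s *\<^sub>R w j + t *\<^sub>R v) = F j (x + t *\<^sub>R v)" for x s
            using inv[of "x + t *\<^sub>R v" s] by (simp add: add_ac)
          then show "invariant_factor (w j) (F\<^sub>t j)"
            unfolding invariant_factor_def F\<^sub>t_def
            by (auto simp: norm_mult inv intro!: mult_le_one 1)
        qed
        have \<eta>1: "norm (\<eta> x) \<le> 1" and \<eta>L: "norm (\<eta> x - \<eta> y) \<le> M * norm (x - y)"
          and \<eta>0: "norm x > R \<Longrightarrow> \<eta> x = 0" for x y
          using \<eta> by (auto simp: amplitude_def)
        have \<eta>L': "norm (\<eta> x - \<eta> y) \<le> max M 0 * norm (x - y)" for x y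
          by (rule order_trans[OF \<eta>L mult_right_mono]) auto
        show "amplitude R (2 * max M 0) \<eta>\<^sub>t"
          unfolding amplitude_def
        proof (intro conjI allI impI)
          fix x y
          show "norm (\<eta>\<^sub>t x) \<le> 1" by (auto simp: \<eta>\<^sub>t_def norm_mult intro!: mult_le_one \<eta>1)
          show "\<eta>\<^sub>t x = 0" if "norm x > R" using \<eta>0[OF that] by (simp add: \<eta>\<^sub>t_def)
          have "\<eta>\<^sub>t x - \<eta>\<^sub>t y = (\<eta> (x + t *\<^sub>R v) - \<eta> (y + t *\<^sub>R v)) * cnj (\<eta> x)
              + \<eta> (y + t *\<^sub>R v) * cnj (\<eta> x - \<eta> y)"
            by (simp add: \<eta>\<^sub>t_def algebra_simps)
          also have "norm \<dots> \<le> max M 0 * norm (x - y) * 1 + 1 * (max M 0 * norm (x - y))"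
            using mult_mono[OF \<eta>L'[of "x + t *\<^sub>R v" "y + t *\<^sub>R v"] \<eta>1[of x]]
              mult_mono[OF \<eta>1[of "y + t *\<^sub>R v"] \<eta>L'[of x y]]
            by (intro order_trans[OF norm_triangle_ineq] add_mono)
               (simp_all add: norm_mult del: complex_cnj_diff)
          finally show "norm (\<eta>\<^sub>t x - \<eta>\<^sub>t y) \<le> 2 * max M 0 * norm (x - y)" by simp
        qed
      qed
      also have "dir_deriv_prod w n (\<lambda>x. P (x + t *\<^sub>R v) - P x) x\<^sub>0 = S (x\<^sub>0 + t *\<^sub>R v) - S x\<^sub>0"
        by (simp add: dir_deriv_prod_difference[OF P] S_def)
      finally show ?thesis .
    qed
    have mid: "norm (\<integral>x. H x * cnj (G (x + s' *\<^sub>R v)) \<partial>lborel) \<le> C\<^sub>3 * A powr (- b)" if s': "s' \<in> {0..1}" for s'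
    proof -
      have m2: "(\<lambda>(s, x). G (x + s *\<^sub>R v) * cnj (G (x + s' *\<^sub>R v))) \<in> borel_measurable (borel \<Otimes>\<^sub>M borel)"
        by measurable
      note fub3 = Fubini_unif_lborel[where f = "\<lambda>s x. G (x + s *\<^sub>R v) * cnj (G (x + s' *\<^sub>R v))" and B = 1
          and R = "R + norm v", OF m2]
      have b2: "norm (G (x + s *\<^sub>R v) * cnj (G (x + s' *\<^sub>R v))) \<le> 1" for x s
        by (auto simp: norm_mult intro!: mult_le_one G1)
      have "(\<integral>x. H x * cnj (G (x + s' *\<^sub>R v)) \<partial>lborel)
          = (\<integral>s. \<integral>x. G (x + s *\<^sub>R v) * cnj (G (x + s' *\<^sub>R v)) \<partial>lborel \<partial>unif)"
        using b2 GK by (subst fub3(1)) (auto simp: H_def)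
      also have "\<dots> = (\<integral>s. \<integral>x. G (x + (s - s') *\<^sub>R v) * cnj (G x) \<partial>lborel \<partial>unif)"
        using integral_lborel_translate[of "\<lambda>x. G (x + (s - s') *\<^sub>R v) * cnj (G x)" "s' *\<^sub>R v" for s]
        by (simp add: algebra_simps)
      finally have eq: "(\<integral>x. H x * cnj (G (x + s' *\<^sub>R v)) \<partial>lborel)
          = (\<integral>s. \<integral>x. G (x + (s - s') *\<^sub>R v) * cnj (G x) \<partial>lborel \<partial>unif)" .
      \<comment> \<open>The line is based at x0 - s' v, so that shift t = 0 corresponds to s = s'.
        This point lies in [0, 1], where a derivative is dominated by the coefficient norm.\<close>
      obtain q where q: "degree q \<le> d" "\<And>s. S ((x\<^sub>0 - s' *\<^sub>R v) + s *\<^sub>R v) = poly q s"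
        using poly_deg_line[OF S] by blast
      define p where "p = q - [:S x\<^sub>0:]"
      have p: "degree p \<le> Suc d" "poly p s = S (x\<^sub>0 + (s - s') *\<^sub>R v) - S x\<^sub>0" for s
        using q degree_diff_le[of q d "[:S x\<^sub>0:]"] by (auto simp: p_def q(2)[symmetric] algebra_simps)
      have "norm (\<integral>s. \<integral>x. G (x + (s - s') *\<^sub>R v) * cnj (G x) \<partial>lborel \<partial>unif)
          \<le> (\<integral>s. C\<^sub>1 * max 1 \<bar>poly p s\<bar> powr (- a) \<partial>unif)"
      proof (rule norm_integral_unif_le[where B = "C\<^sub>1 * 1"])
        have "(\<lambda>s. \<integral>x. G (x + s *\<^sub>R v) * cnj (G (x + s' *\<^sub>R v)) \<partial>lborel) \<in> borel_measurable borel"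
          using borel_measurable_integrable[OF fub3(3)] b2 GK by auto
        then show "(\<lambda>s. \<integral>x. G (x + (s - s') *\<^sub>R v) * cnj (G x) \<partial>lborel) \<in> borel_measurable borel"
          using integral_lborel_translate[of "\<lambda>x. G (x + (s - s') *\<^sub>R v) * cnj (G x)" "s' *\<^sub>R v" for s]
          by (simp add: algebra_simps)
        show "(\<lambda>s. C\<^sub>1 * max 1 \<bar>poly p s\<bar> powr (- a)) \<in> borel_measurable borel"
        proof -
          have [measurable]: "poly p \<in> borel_measurable borel"
            by (intro borel_measurable_continuous_onI continuous_intros)
          show ?thesis by measurable
        qed
        show "norm (\<integral>x. G (x + (s - s') *\<^sub>R v) * cnj (G x) \<partial>lborel) \<le> C\<^sub>1 * max 1 \<bar>poly p s\<bar> powr (- a)" for s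
          using inner[of "s - s'"] by (simp add: p)
        show "C\<^sub>1 * max 1 \<bar>poly p s\<bar> powr (- a) \<le> C\<^sub>1 * 1" for s
          using C1 by (intro mult_left_mono max_1_powr_le_1) auto
      qed
      also have "\<dots> \<le> C\<^sub>1 * (C\<^sub>2 * max 1 (coeff_norm p) powr (- b))"
        using C2(3)[OF p(1)] C1(1) by (simp add: mult_left_mono)
      \<comment> \<open>Subtracting the constant S(x0) leaves the derivative at s' unchanged; it
        equals the directional derivative whose size defines A. This gives the lower bound A / (d +
        1) and explains the power of \<open>Suc d\<close> in \<open>C\<^sub>3\<close>.\<close>
      also have "\<dots> \<le> C\<^sub>1 * (C\<^sub>2 * (A / real (Suc d)) powr (- b))"
      proof (intro mult_left_mono powr_mono2')
        have "poly (pderiv q) s' = dir_deriv v S x\<^sub>0"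
          using poly_pderiv_line[OF S q(2), of s'] by simp
        moreover have "pderiv p = pderiv q" by (simp add: p_def pderiv_diff)
        ultimately have "\<bar>dir_deriv v S x\<^sub>0\<bar> \<le> real (Suc d) * coeff_norm p"
          using poly_pderiv_le_coeff_norm[OF _ p(1), of s'] s' by auto
        also have "\<dots> \<le> real (Suc d) * max 1 (coeff_norm p)" by (intro mult_left_mono) auto
        finally have "A \<le> real (Suc d) * max 1 (coeff_norm p)"
          unfolding A_def using mult_mono[of 1 "real (Suc d)" 1 "max 1 (coeff_norm p)"] by simp
        then show "A / real (Suc d) \<le> max 1 (coeff_norm p)" by (simp add: field_simps)
      qed (use A C1 C2 in auto)
      also have "\<dots> = C\<^sub>3 * A powr (- b)"
        using A by (simp add: C\<^sub>3_def powr_divide powr_minus field_simps)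
      finally show ?thesis unfolding eq .
    qed
    have sq: "(\<integral>x. (norm (H x))\<^sup>2 \<partial>lborel) \<le> C\<^sub>3 * A powr (- b)"
    proof -
      have m4: "(\<lambda>(s, x). H x * cnj (G (x + s *\<^sub>R v))) \<in> borel_measurable (borel \<Otimes>\<^sub>M borel)"
        by measurable
      note fub4 = Fubini_unif_lborel[where f = "\<lambda>s x. H x * cnj (G (x + s *\<^sub>R v))" and B = 1
          and R = "R + norm v", OF m4]
      have b4: "norm (H x * cnj (G (x + s *\<^sub>R v))) \<le> 1" for x s
        by (auto simp: norm_mult intro!: mult_le_one G1 H1)
      have "complex_of_real (\<integral>x. (norm (H x))\<^sup>2 \<partial>lborel) = (\<integral>x. complex_of_real ((norm (H x))\<^sup>2) \<partial>lborel)"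
        by (rule integral_complex_of_real[symmetric])
      also have "\<dots> = (\<integral>x. H x * cnj (H x) \<partial>lborel)" by (simp only: complex_norm_square)
      \<comment> \<open>Only the conjugated copy of H is unfolded here; the other one is unfolded in
        \<open>mid\<close>, where the parameter of the first copy is fixed.\<close>
      also have "\<dots> = (\<integral>s. \<integral>x. H x * cnj (G (x + s *\<^sub>R v)) \<partial>lborel \<partial>unif)"
        using b4 GK by (subst fub4(1)) (auto simp: H_def simp flip: integral_cnj)
      finally have eq: "complex_of_real (\<integral>x. (norm (H x))\<^sup>2 \<partial>lborel)
          = (\<integral>s. \<integral>x. H x * cnj (G (x + s *\<^sub>R v)) \<partial>lborel \<partial>unif)" .
      have "norm (\<integral>s. \<integral>x. H x * cnj (G (x + s *\<^sub>R v)) \<partial>lborel \<partial>unif) \<le> C\<^sub>3 * A powr (- b)"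
        by (rule norm_integral_unif_le_const[OF _ mid])
           (use borel_measurable_integrable[OF fub4(3)] b4 GK in auto)
      then show ?thesis unfolding eq[symmetric] norm_of_real by linarith
    qed
    \<comment> \<open>The square root of the decay of the square integral. On K the pointwise
      inequality |H| \<le> c + |H|^2 / c replaces Cauchy-Schwarz, and with this c both terms
      integrate to O(c).\<close>
    define c where "c = A powr (- (b / 2))"
    have c: "0 < c" using A by (simp add: c_def)
    have "(\<integral>x. norm (H x) \<partial>lborel) \<le> (\<integral>x. indicator K x * c + (norm (H x))\<^sup>2 / c \<partial>lborel)"
    proof (rule integral_mono[OF intH(1)])
      show "integrable lborel (\<lambda>x. indicator K x * c + (norm (H x))\<^sup>2 / c)"
        using Kfin intH(2)
        by (intro Bochner_Integration.integrable_add integrable_mult_left integrable_divide)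
           (auto simp: integrable_indicator_iff)
      fix x
      show "norm (H x) \<le> indicator K x * c + (norm (H x))\<^sup>2 / c"
      proof (cases "x \<in> K")
        case True
        have "norm (H x) * c \<le> c\<^sup>2 + (norm (H x))\<^sup>2"
        proof -
          have "0 \<le> norm (H x) * c" using c by simp
          then show ?thesis using sum_squares_bound[of "norm (H x)" c] by linarith
        qed
        then show ?thesis using True c by (simp add: field_simps power2_eq_square)
      qed (use H0 in \<open>auto simp: K_def\<close>)
    qed
    also have "\<dots> = measure lborel K * c + (\<integral>x. (norm (H x))\<^sup>2 \<partial>lborel) / c"
      using Kfin intH(2)
      by (subst Bochner_Integration.integral_add) (auto simp: integrable_indicator_iff)
    also have "\<dots> \<le> measure lborel K * c + C\<^sub>3 * A powr (- b) / c"
      using sq c by (intro add_mono divide_right_mono) auto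
    also have "C\<^sub>3 * A powr (- b) / c = C\<^sub>3 * c"
    proof -
      have "A powr (- b) = c * c" by (simp add: c_def flip: powr_add)
      then show ?thesis using c by simp
    qed
    finally have "norm \<Lambda> \<le> (measure lborel K + C\<^sub>3) * c" using \<Lambda> by (simp add: distrib_right)
    moreover have "\<Lambda> = integral\<^sup>L lborel (osc_integrand P (Suc n) F \<eta>)"
      unfolding \<Lambda>_def by (intro Bochner_Integration.integral_cong) (auto simp: G_def osc_integrand_def F'_def mult_ac)
    ultimately show ?thesis by (simp add: c_def A_def S_def v_def)
  qed
  moreover have "0 \<le> measure lborel K + C\<^sub>3" "0 < b / 2" using C2 C3 by auto
  ultimately show ?thesis by (intro exI decay_boundI)
qed

lemma decay_bound_exists:
  assumes "1 \<le> n" shows "\<exists>C \<epsilon>. decay_bound w n d R M \<rho> C \<epsilon>"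
  using assms
  by (induction n arbitrary: M rule: nat_induct_at_least) (auto intro: decay_bound_1[simplified] decay_bound_Suc)

section \<open>Orthogonal projections and null sets\<close>

lemma orth_proj_eq:
  fixes V :: "'a::euclidean_space set"
  assumes "subspace V" "v \<in> V" "x - v \<in> V\<^sup>\<bottom>"
  shows "orth_proj V x = v"
  unfolding orth_proj_def using orth_proj_unique[OF assms(1), of x] assms(2,3) by (intro the1_equality) auto

lemma orth_proj_mem:
  fixes V :: "'a::euclidean_space set"
  assumes "subspace V"
  shows "orth_proj V x \<in> V" "x - orth_proj V x \<in> V\<^sup>\<bottom>"
  using theI'[OF orth_proj_unique[OF assms, of x]] by (auto simp: orth_proj_def)

text \<open>This makes f o pi an invariant factor in every direction orthogonal to V, in particular
  along w_j.\<close>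

lemma orth_proj_add_orthogonal:
  fixes V :: "'a::euclidean_space set"
  assumes "subspace V" "u \<in> V\<^sup>\<bottom>"
  shows "orth_proj V (x + s *\<^sub>R u) = orth_proj V x"
proof (rule orth_proj_eq[OF assms(1) orth_proj_mem(1)[OF assms(1)]])
  have "(x - orth_proj V x) + s *\<^sub>R u \<in> V\<^sup>\<bottom>"
    by (intro subspace_add subspace_mul subspace_orthogonal_comp orth_proj_mem assms)
  then show "x + s *\<^sub>R u - orth_proj V x \<in> V\<^sup>\<bottom>" by (simp add: algebra_simps)
qed

lemma orthonormal_basis_finite:
  fixes B :: "'a::euclidean_space set"
  assumes "orthonormal_basis V B" shows "finite B" "independent B"
proof -
  have "independent B"
    using assms unfolding orthonormal_basis_def by (intro pairwise_orthogonal_independent) auto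
  then show "finite B" "independent B" using independent_imp_finite by auto
qed

lemma orth_proj_orthonormal_basis:
  fixes V :: "'a::euclidean_space set"
  assumes "subspace V" and B: "orthonormal_basis V B"
  shows "orth_proj V x = (\<Sum>b\<in>B. (x \<bullet> b) *\<^sub>R b)"
proof -
  have fin: "finite B" by (rule orthonormal_basis_finite[OF B])
  have V: "orth_proj V x \<in> span B"
    using orth_proj_mem(1)[OF assms(1)] B by (simp add: orthonormal_basis_def)
  have "orth_proj V x \<bullet> b = x \<bullet> b" if "b \<in> B" for b
  proof -
    have "orthogonal b (x - orth_proj V x)"
      using orth_proj_mem(2)[OF assms(1), of x] that B
      by (auto simp: orthonormal_basis_def orthogonal_comp_def)
    then show ?thesis by (simp add: orthogonal_def inner_diff_right inner_commute)
  qed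
  then have "(\<Sum>b\<in>B. (x \<bullet> b) *\<^sub>R b) = (\<Sum>b\<in>B. (orth_proj V x \<bullet> b) *\<^sub>R b)" by simp
  also have "\<dots> = orth_proj V x"
    using B by (intro orthonormal_basis_expand V fin) (auto simp: orthonormal_basis_def)
  finally show ?thesis by simp
qed

lemma orth_proj_measurable:
  fixes V :: "'a::euclidean_space set"
  assumes "subspace V"
  shows "orth_proj V \<in> borel \<rightarrow>\<^sub>M restrict_space borel V"
proof (rule measurable_restrict_space2)
  obtain B where B: "orthonormal_basis V B" using orthonormal_basis_exists[OF assms] by blast
  show "orth_proj V \<in> borel_measurable borel"
    unfolding orth_proj_orthonormal_basis[OF assms B, abs_def] by measurable
qed (use orth_proj_mem[OF assms] in auto)

lemma orthonormal_basis_extend: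
  fixes V :: "'a::euclidean_space set"
  assumes "subspace V" and B: "orthonormal_basis V B"
  obtains C where "B \<inter> C = {}" "orthonormal_basis UNIV (B \<union> C)"
proof -
  obtain C where C: "orthonormal_basis (V\<^sup>\<bottom>) C"
    using orthonormal_basis_exists[OF subspace_orthogonal_comp] by blast
  have orth: "orthogonal b c" if "b \<in> B" "c \<in> C" for b c
    using B C that by (auto simp: orthonormal_basis_def orthogonal_comp_def)
  have orth': "orthogonal c b" if "b \<in> B" "c \<in> C" for b c
    using orth[OF that] by (simp only: orthogonal_commute)
  have "B \<inter> C = {}"
  proof (rule ccontr)
    assume "B \<inter> C \<noteq> {}"
    then obtain b where "b \<in> B" "b \<in> C" by auto
    then have "b = 0" "norm b = 1" using orth[of b b] B by (auto simp: orthogonal_self orthonormal_basis_def)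
    then show False by simp
  qed
  moreover have "orthonormal_basis UNIV (B \<union> C)"
    unfolding orthonormal_basis_def
  proof (intro conjI)
    show "span (B \<union> C) = UNIV"
      using B C subspace_sum_orthogonal_comp[OF assms(1)] unfolding orthonormal_basis_def span_Un
      by (auto simp: set_plus_def set_eq_iff) metis
    show "pairwise orthogonal (B \<union> C)"
      using B C orth orth' unfolding orthonormal_basis_def pairwise_def
      by auto
  qed (use B C in \<open>auto simp: orthonormal_basis_def\<close>)
  ultimately show thesis by (rule that)
qed

section \<open>Lebesgue measure in orthonormal coordinates; preimages of null sets\<close>

interpretation lborel_PiM: product_sigma_finite "\<lambda>_. lborel :: real measure" ..

text \<open>A mere relabelling of coordinates: the index set E is matched with the standard basis,
  and the two measures agree on boxes. No rotation takes place here.\<close>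

lemma distr_PiM_lborel_eq_lborel:
  fixes \<phi> :: "'b \<Rightarrow> 'a::euclidean_space"
  assumes "finite E" and \<phi>: "bij_betw \<phi> E Basis"
  shows "distr (\<Pi>\<^sub>M e\<in>E. lborel) borel (\<lambda>t. \<Sum>e\<in>E. t e *\<^sub>R \<phi> e) = lborel"
proof (rule lborel_eqI[symmetric])
  interpret finite_product_sigma_finite "\<lambda>_. lborel :: real measure" E by standard fact
  have m [measurable]: "(\<lambda>t. \<Sum>e\<in>E. t e *\<^sub>R \<phi> e) \<in> (\<Pi>\<^sub>M e\<in>E. (lborel :: real measure)) \<rightarrow>\<^sub>M borel"
    by measurable
  fix l u :: 'a assume le: "\<And>b. b \<in> Basis \<Longrightarrow> l \<bullet> b \<le> u \<bullet> b"
  have inj: "inj_on \<phi> E" and im: "\<phi> ` E = Basis" using \<phi> by (auto simp: bij_betw_def)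
  have inner: "(\<Sum>e\<in>E. t e *\<^sub>R \<phi> e) \<bullet> \<phi> e' = t e'" if "e' \<in> E" for t :: "'b \<Rightarrow> real" and e'
  proof -
    have "(\<Sum>e\<in>E. t e *\<^sub>R \<phi> e) \<bullet> \<phi> e' = (\<Sum>e\<in>E. if e = e' then t e else 0)"
      unfolding inner_sum_left
    proof (rule sum.cong[OF refl])
      fix e assume "e \<in> E"
      then have "\<phi> e \<in> Basis" "\<phi> e' \<in> Basis" "\<phi> e = \<phi> e' \<longleftrightarrow> e = e'"
        using im inj that by (auto dest: inj_onD)
      then show "(t e *\<^sub>R \<phi> e) \<bullet> \<phi> e' = (if e = e' then t e else 0)" by (simp add: inner_Basis)
    qed
    also have "\<dots> = t e'" using that assms(1) by simp
    finally show ?thesis .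
  qed
  have "(\<lambda>t. \<Sum>e\<in>E. t e *\<^sub>R \<phi> e) -` box l u \<inter> space (\<Pi>\<^sub>M e\<in>E. (lborel :: real measure))
      = Pi\<^sub>E E (\<lambda>e. {l \<bullet> \<phi> e <..< u \<bullet> \<phi> e})"
  proof -
    have "(\<Sum>e\<in>E. t e *\<^sub>R \<phi> e) \<in> box l u \<longleftrightarrow> (\<forall>e\<in>E. t e \<in> {l \<bullet> \<phi> e <..< u \<bullet> \<phi> e})" for t
      unfolding box_def im[symmetric] by (auto simp: inner)
    then show ?thesis by (auto simp: space_PiM PiE_iff)
  qed
  then have "emeasure (distr (\<Pi>\<^sub>M e\<in>E. lborel) borel (\<lambda>t. \<Sum>e\<in>E. t e *\<^sub>R \<phi> e)) (box l u)
      = emeasure (\<Pi>\<^sub>M e\<in>E. lborel) (Pi\<^sub>E E (\<lambda>e. {l \<bullet> \<phi> e <..< u \<bullet> \<phi> e}))"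
    by (simp add: emeasure_distr)
  also have "\<dots> = (\<Prod>e\<in>E. emeasure lborel {l \<bullet> \<phi> e <..< u \<bullet> \<phi> e})"
    by (rule measure_times) auto
  also have "\<dots> = (\<Prod>e\<in>E. ennreal ((u - l) \<bullet> \<phi> e))"
  proof (intro prod.cong refl)
    fix e assume "e \<in> E"
    then have "\<phi> e \<in> Basis" using im by auto
    from le[OF this] show "emeasure lborel {l \<bullet> \<phi> e <..< u \<bullet> \<phi> e} = ennreal ((u - l) \<bullet> \<phi> e)"
      by (simp add: inner_diff_left)
  qed
  also have "\<dots> = (\<Prod>b\<in>Basis. ennreal ((u - l) \<bullet> b))"
    unfolding im[symmetric] by (simp add: prod.reindex[OF inj])
  also have "\<dots> = ennreal (\<Prod>b\<in>Basis. (u - l) \<bullet> b)"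
    using le by (intro prod_ennreal) (auto simp: inner_diff_left)
  finally show "emeasure (distr (\<Pi>\<^sub>M e\<in>E. lborel) borel (\<lambda>t. \<Sum>e\<in>E. t e *\<^sub>R \<phi> e)) (box l u)
      = ennreal (\<Prod>b\<in>Basis. (u - l) \<bullet> b)" .
qed simp

lemma null_sets_PiM_restrict:
  assumes "B \<inter> C = {}" "finite B" "finite C"
    and N: "N \<in> null_sets (\<Pi>\<^sub>M b\<in>B. (lborel :: real measure))"
  shows "{t \<in> space (\<Pi>\<^sub>M e\<in>B \<union> C. (lborel :: real measure)). restrict t B \<in> N}
    \<in> null_sets (\<Pi>\<^sub>M e\<in>B \<union> C. (lborel :: real measure))"
proof
  let ?M = "\<lambda>I. \<Pi>\<^sub>M e\<in>I. (lborel :: real measure)"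
  let ?Z = "{t \<in> space (?M (B \<union> C)). restrict t B \<in> N}"
  interpret C: finite_product_sigma_finite "\<lambda>_. lborel :: real measure" C by standard fact
  have [measurable]: "N \<in> sets (?M B)" using N by auto
  show Z: "?Z \<in> sets (?M (B \<union> C))" by measurable
  have "emeasure (?M (B \<union> C)) ?Z = emeasure (distr (?M B \<Otimes>\<^sub>M ?M C) (?M (B \<union> C)) (merge B C)) ?Z"
    using lborel_PiM.distr_merge[OF assms(1-3)] by simp
  also have "\<dots> = emeasure (?M B \<Otimes>\<^sub>M ?M C) (merge B C -` ?Z \<inter> space (?M B \<Otimes>\<^sub>M ?M C))"
    by (rule emeasure_distr[OF measurable_merge Z])
  also have "merge B C -` ?Z \<inter> space (?M B \<Otimes>\<^sub>M ?M C) = N \<times> space (?M C)"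
  proof -
    have "merge B C z \<in> space (?M (B \<union> C))" if "z \<in> space (?M B \<Otimes>\<^sub>M ?M C)" for z
      using that by (rule measurable_space[OF measurable_merge])
    moreover have "restrict (merge B C z) B = fst z" if "z \<in> space (?M B \<Otimes>\<^sub>M ?M C)" for z
      using that
      by (cases z) (auto simp: space_pair_measure space_PiM PiE_def extensional_def merge_def fun_eq_iff)
    moreover have "N \<subseteq> space (?M B)" by (rule sets.sets_into_space) simp
    ultimately show ?thesis by (auto simp: space_pair_measure)
  qed
  also have "emeasure (?M B \<Otimes>\<^sub>M ?M C) (N \<times> space (?M C)) = emeasure (?M B) N * emeasure (?M C) (space (?M C))"
    by (rule C.emeasure_pair_measure_Times) auto
  \<comment> \<open>The second factor may be infinite; zero times infinity is zero in
    \<open>ennreal\<close>.\<close>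
  also have "\<dots> = 0" using N by auto
  finally show "emeasure (?M (B \<union> C)) ?Z = 0" .
qed

text \<open>In orthonormal coordinates adapted to V and its complement, the preimage of a null set
  is a cylinder over it, hence null. The cylinder is first placed in standard coordinates, where
  Lebesgue measure is a product, and then carried to the adapted ones by a linear map; linear maps
  preserve negligibility, so no rotation invariance of the measure has to be invoked.\<close>

lemma AE_orth_proj:
  fixes V :: "'a::euclidean_space set"
  assumes V: "subspace V" and Q: "AE y in subspace_lebesgue V. Q y"
  shows "AE x in lebesgue. Q (orth_proj V x)"
proof -
  define B where "B = (SOME B. orthonormal_basis V B)"
  have B: "orthonormal_basis V B"
    unfolding B_def using orthonormal_basis_exists[OF V] by (rule someI_ex)
  define h where "h t = (\<Sum>b\<in>B. t b *\<^sub>R b)" for t :: "'a \<Rightarrow> real"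
  define D where "D = distr (\<Pi>\<^sub>M b\<in>B. (lborel :: real measure)) (restrict_space borel V) h"
  have sub: "subspace_lebesgue V = completion D"
    by (simp add: subspace_lebesgue_def Let_def B_def[symmetric] D_def h_def[abs_def])
  obtain C where C: "B \<inter> C = {}" "orthonormal_basis UNIV (B \<union> C)"
    using orthonormal_basis_extend[OF V B] by blast
  define E where "E = B \<union> C"
  have E: "orthonormal_basis UNIV E" using C by (simp add: E_def)
  have fin: "finite E" and ind: "independent E" using orthonormal_basis_finite[OF E] by auto
  then have finB: "finite B" "finite C" by (auto simp: E_def)
  have BV: "B \<subseteq> V" using B by (simp add: orthonormal_basis_def)
  have "h \<in> borel_measurable (\<Pi>\<^sub>M b\<in>B. (lborel :: real measure))" unfolding h_def[abs_def] by measurable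
  moreover have hV: "h t \<in> V" for t
    unfolding h_def using BV V by (intro subspace_sum subspace_mul) auto
  ultimately have hm: "h \<in> (\<Pi>\<^sub>M b\<in>B. (lborel :: real measure)) \<rightarrow>\<^sub>M restrict_space borel V"
    by (intro measurable_restrict_space2) auto
  have "card E = DIM('a)"
    using E dim_eq_card_independent[OF ind] dim_span[of E] by (simp add: orthonormal_basis_def)
  then obtain \<phi> where \<phi>: "bij_betw \<phi> E (Basis :: 'a set)"
    using finite_same_card_bij[OF fin finite_Basis] by auto
  then have inj: "inj_on \<phi> E" and im: "\<phi> ` E = Basis" by (auto simp: bij_betw_def)
  have \<phi>i: "\<phi> e \<bullet> \<phi> e' = (if e = e' then 1 else 0)" if "e \<in> E" "e' \<in> E" for e e'
    using that im inj by (subst inner_Basis) (auto dest: inj_onD)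
  have "AE y in D. Q y" using Q unfolding sub by (simp add: AE_completion_iff)
  then obtain N where N: "{y \<in> space D. \<not> Q y} \<subseteq> N" "N \<in> sets D" "emeasure D N = 0"
    by (rule AE_E) auto
  have spD: "space D = V" by (simp add: D_def space_restrict_space)
  have Ns: "N \<in> sets (restrict_space borel V)" using N(2) by (simp add: D_def)
  have Nb: "N \<in> sets borel"
  proof -
    have "V \<in> sets borel" using closed_subspace[OF V] by simp
    then show ?thesis using Ns by (simp add: sets_restrict_space_iff)
  qed
  define N' where "N' = h -` N \<inter> space (\<Pi>\<^sub>M b\<in>B. (lborel :: real measure))"
  have N': "N' \<in> null_sets (\<Pi>\<^sub>M b\<in>B. (lborel :: real measure))"
  proof
    show "N' \<in> sets (\<Pi>\<^sub>M b\<in>B. (lborel :: real measure))"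
      unfolding N'_def by (rule measurable_sets[OF hm Ns])
    show "emeasure (\<Pi>\<^sub>M b\<in>B. (lborel :: real measure)) N' = 0"
      using N(3) unfolding D_def N'_def by (subst (asm) emeasure_distr[OF hm Ns])
  qed
  \<comment> \<open>The cylinder over N in standard coordinates: the coordinate along
    \<open>\<phi> b\<close> plays the role of the coordinate along b.\<close>
  define Z where "Z = {y :: 'a. (\<Sum>b\<in>B. (y \<bullet> \<phi> b) *\<^sub>R b) \<in> N}"
  have Zb [measurable]: "Z \<in> sets borel"
  proof -
    have "(\<lambda>y :: 'a. \<Sum>b\<in>B. (y \<bullet> \<phi> b) *\<^sub>R b) \<in> borel_measurable borel" by measurable
    from measurable_sets[OF this Nb] show ?thesis by (simp add: Z_def vimage_def)
  qed
  have "emeasure lborel Z = 0"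
  proof -
    let ?g = "\<lambda>t. \<Sum>e\<in>E. t e *\<^sub>R \<phi> e"
    have g: "?g \<in> borel_measurable (\<Pi>\<^sub>M e\<in>E. (lborel :: real measure))" by measurable
    have gi: "?g t \<bullet> \<phi> e = t e" if "e \<in> E" for t :: "'a \<Rightarrow> real" and e
      using that fin by (simp add: inner_sum_left \<phi>i if_distrib cong: if_cong)
    have vim: "?g -` Z \<inter> space (\<Pi>\<^sub>M e\<in>E. (lborel :: real measure))
        = {t \<in> space (\<Pi>\<^sub>M e\<in>B \<union> C. (lborel :: real measure)). restrict t B \<in> N'}"
    proof -
      have "(\<Sum>b\<in>B. (?g t \<bullet> \<phi> b) *\<^sub>R b) = h (restrict t B)" for t
        unfolding h_def
      proof (intro sum.cong refl)
        fix b assume b: "b \<in> B"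
        then have "b \<in> E" by (simp add: E_def)
        from gi[OF this] b show "(?g t \<bullet> \<phi> b) *\<^sub>R b = restrict t B b *\<^sub>R b" by simp
      qed
      then have "?g t \<in> Z \<longleftrightarrow> h (restrict t B) \<in> N" for t by (simp add: Z_def)
      moreover have "restrict t B \<in> space (\<Pi>\<^sub>M b\<in>B. (lborel :: real measure))" for t :: "'a \<Rightarrow> real"
        by (simp add: space_PiM)
      ultimately show ?thesis by (auto simp: N'_def E_def)
    qed
    have "emeasure (distr (\<Pi>\<^sub>M e\<in>E. lborel) borel ?g) Z = 0"
      unfolding emeasure_distr[OF g Zb] vim
      using null_setsD1[OF null_sets_PiM_restrict[OF C(1) finB N']] by (simp only: E_def)
    then show ?thesis unfolding distr_PiM_lborel_eq_lborel[OF fin \<phi>] .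
  qed
  then have "Z \<in> null_sets lebesgue" using Zb by (intro null_sets_completionI) auto
  then have Z0: "negligible Z" by (simp add: negligible_iff_null_sets)
  \<comment> \<open>The orthogonal map sending each \<open>\<phi> e\<close> to e. It maps Z onto a
    set containing all x whose projection falls in N.\<close>
  define T where "T y = (\<Sum>e\<in>E. (y \<bullet> \<phi> e) *\<^sub>R e)" for y :: 'a
  have "bounded_linear T" unfolding T_def
    by (intro bounded_linear_sum bounded_linear_scaleR_const bounded_linear_inner_left)
  then have "T differentiable_on Z" by (rule bounded_linear_imp_differentiable_on)
  with Z0 have TZ: "negligible (T ` Z)" by (intro negligible_differentiable_image_negligible) auto
  have "x \<in> T ` Z" if "\<not> Q (orth_proj V x)" for x
  proof
    define y where "y = (\<Sum>e\<in>E. (x \<bullet> e) *\<^sub>R \<phi> e)"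
    have y: "y \<bullet> \<phi> e = x \<bullet> e" if "e \<in> E" for e
      using that fin by (simp add: y_def inner_sum_left \<phi>i if_distrib cong: if_cong)
    show "x = T y"
      using orthonormal_basis_expand[of E x] E fin y by (simp add: T_def orthonormal_basis_def)
    have "orth_proj V x \<in> N"
      using N(1) that orth_proj_mem(1)[OF V, of x] by (auto simp: spD)
    moreover have "orth_proj V x = (\<Sum>b\<in>B. (y \<bullet> \<phi> b) *\<^sub>R b)"
      unfolding orth_proj_orthonormal_basis[OF V B] by (intro sum.cong refl) (simp add: y E_def)
    ultimately show "y \<in> Z" by (simp add: Z_def)
  qed
  then show ?thesis
    using TZ by (intro AE_I'[of "T ` Z"]) (auto simp: negligible_iff_null_sets)
qed

section \<open>Reduction to bounded Borel factors\<close>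

text \<open>f agrees almost everywhere with a Borel function g on V. Composing with the projection,
  cutting off where the norm is exceeded and dividing by the norm gives a factor bounded by 1
  everywhere; by \<open>AE_orth_proj\<close> the changes affect a null set of the ambient space
  only.\<close>

lemma Linf_invariant_factor:
  fixes V :: "'a::euclidean_space set"
  assumes V: "subspace V" and f: "f \<in> Linf V" and u: "u \<in> V\<^sup>\<bottom>"
  obtains F where "0 \<le> Linf_norm V f" "invariant_factor u F"
    "AE x in lebesgue. f (orth_proj V x) = of_real (Linf_norm V f) * F x"
proof -
  obtain D where D: "subspace_lebesgue V = completion D" and sD [measurable_cong]: "sets D = sets (restrict_space borel V)"
    unfolding subspace_lebesgue_def Let_def by (auto intro: that)
  define \<sigma> where "\<sigma> = esssup (subspace_lebesgue V) (\<lambda>y. ereal (norm (f y)))"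
  define L where "L = Linf_norm V f"
  have fm: "f \<in> borel_measurable (completion D)" and \<sigma>fin: "\<sigma> < \<infinity>"
    using f by (auto simp: Linf_def D[symmetric] \<sigma>_def)
  have "AE y in subspace_lebesgue V. ereal (norm (f y)) \<le> \<sigma>" unfolding \<sigma>_def by (rule esssup_AE)
  from AE_orth_proj[OF V this] have le: "AE x in lebesgue. ereal (norm (f (orth_proj V x))) \<le> \<sigma>" .
  \<comment> \<open>The essential supremum lives in \<open>ereal\<close> and is not nonnegative by
    definition. A negative value would contradict \<open>le\<close> at every point, although
    \<open>le\<close> holds almost everywhere for a nonzero measure.\<close>
  have "0 \<le> \<sigma>"
  proof (rule ccontr)
    assume "\<not> 0 \<le> \<sigma>"
    then have "\<not> ereal (norm (f (orth_proj V x))) \<le> \<sigma>" for x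
      by (metis ereal_less_eq(5) norm_ge_zero order_trans)
    then have "AE x in (lebesgue :: 'a measure). False" using le by simp
    then show False
      by (simp add: eventually_False ae_filter_eq_bot_iff)
  qed
  then have L: "0 \<le> L" "\<sigma> = ereal L"
    using \<sigma>fin by (auto simp: L_def Linf_norm_def \<sigma>_def[symmetric] ereal_real real_of_ereal_pos)
  have "(\<lambda>y. Re (f y)) \<in> borel_measurable (completion D)" "(\<lambda>y. Im (f y)) \<in> borel_measurable (completion D)"
    using fm by auto
  from this[THEN completion_ex_borel_measurable_real] obtain g\<^sub>1 g\<^sub>2
    where g1: "g\<^sub>1 \<in> borel_measurable D" "AE y in D. Re (f y) = g\<^sub>1 y"
      and g2: "g\<^sub>2 \<in> borel_measurable D" "AE y in D. Im (f y) = g\<^sub>2 y" by blast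
  define g where "g y = Complex (g\<^sub>1 y) (g\<^sub>2 y)" for y
  have g: "g \<in> borel_measurable (restrict_space borel V)"
  proof -
    have "g\<^sub>1 \<in> borel_measurable (restrict_space borel V)" "g\<^sub>2 \<in> borel_measurable (restrict_space borel V)"
      using g1(1) g2(1) by (simp_all add: measurable_cong_sets[OF sD refl])
    then show ?thesis unfolding g_def[abs_def] Complex_eq by measurable
  qed
  have "AE y in subspace_lebesgue V. f y = g y"
    unfolding D AE_completion_iff using g1(2) g2(2)
    by eventually_elim (simp add: g_def complex_eq_iff)
  from AE_orth_proj[OF V this] have fg: "AE x in lebesgue. f (orth_proj V x) = g (orth_proj V x)" .
  define G where "G x = g (orth_proj V x)" for x
  have [measurable]: "G \<in> borel_measurable borel"
    unfolding G_def using measurable_compose[OF orth_proj_measurable[OF V] g] .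
  \<comment> \<open>For L = 0 the division yields 0, in accordance with f vanishing almost
    everywhere.\<close>
  define F where "F x = (if norm (G x) \<le> L then G x / of_real L else 0)" for x
  show thesis
  proof
    show "0 \<le> Linf_norm V f" using L by (simp add: L_def)
    show "invariant_factor u F"
      unfolding invariant_factor_def
    proof (intro conjI allI)
      show "F \<in> borel_measurable borel" unfolding F_def[abs_def] by measurable
      show "norm (F x) \<le> 1" for x using L by (auto simp: F_def norm_divide divide_le_eq_1)
      show "F (x + s *\<^sub>R u) = F x" for x s
        using orth_proj_add_orthogonal[OF V u, of x s] by (simp add: F_def G_def)
    qed
    show "AE x in lebesgue. f (orth_proj V x) = of_real (Linf_norm V f) * F x"
      using le fg
    proof eventually_elim
      case (elim x)
      then have "norm (G x) \<le> L" by (simp add: L G_def)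
      then show ?case using elim L by (cases "L = 0") (auto simp: F_def G_def L_def[symmetric])
    qed
  qed
qed

text \<open>Everything is scaled to size 1: the factors by their norms and the amplitude by K, which
  bounds both its values and its Lipschitz constant, whence M = 1. The parameter \<open>lam\<close>
  moves into the phase and comes out again by linearity of the differential operator.\<close>

lemma osc_form_bound:
  fixes V :: "nat \<Rightarrow> 'a::euclidean_space set"
  assumes decay: "decay_bound w n d R 1 \<rho> C \<epsilon>"
    and V: "\<And>j. j \<in> {1..n} \<Longrightarrow> subspace (V j)" and w: "\<And>j. j \<in> {1..n} \<Longrightarrow> w j \<in> (V j)\<^sup>\<bottom>"
    and P: "poly_deg d P" and x0: "norm x\<^sub>0 \<le> \<rho>" and f: "\<And>j. j \<in> {1..n} \<Longrightarrow> f j \<in> Linf (V j)"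
    and \<eta>: "\<And>x. norm (\<eta> x) \<le> K" "\<And>x y. norm (\<eta> x - \<eta> y) \<le> K * norm (x - y)"
      "\<And>x. norm x > R \<Longrightarrow> \<eta> x = 0"
  shows "norm (osc_form V n P \<eta> lam f)
    \<le> K * C * max 1 (\<bar>lam\<bar> * \<bar>dir_deriv_prod w n P x\<^sub>0\<bar>) powr (- \<epsilon>) * (\<Prod>j=1..n. Linf_norm (V j) (f j))"
proof -
  define L where "L j = Linf_norm (V j) (f j)" for j
  have "\<exists>F. 0 \<le> L j \<and> invariant_factor (w j) F \<and>
      (AE x in lebesgue. f j (orth_proj (V j) x) = of_real (L j) * F x)" if "j \<in> {1..n}" for j
    using Linf_invariant_factor[OF V[OF that] f[OF that] w[OF that]] unfolding L_def by metis
  then obtain F where F: "\<And>j. j \<in> {1..n} \<Longrightarrow> 0 \<le> L j" "\<And>j. j \<in> {1..n} \<Longrightarrow> invariant_factor (w j) (F j)"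
    "\<And>j. j \<in> {1..n} \<Longrightarrow> AE x in lebesgue. f j (orth_proj (V j) x) = of_real (L j) * F j x"
    by metis
  have K: "0 \<le> K" using \<eta>(1)[of 0] norm_ge_zero order_trans by blast
  have L: "0 \<le> (\<Prod>j=1..n. L j)" using F(1) by (intro prod_nonneg) auto
  define \<eta>' where "\<eta>' x = \<eta> x / of_real K" for x
  have \<eta>': "\<eta> x = of_real K * \<eta>' x" for x using \<eta>(1)[of x] by (cases "K = 0") (auto simp: \<eta>'_def)
  have amp: "amplitude R 1 \<eta>'"
    unfolding amplitude_def
  proof (intro conjI allI impI)
    fix x y
    show "norm (\<eta>' x) \<le> 1" using \<eta>(1)[of x] K by (auto simp: \<eta>'_def norm_divide divide_le_eq_1)
    have "norm (\<eta>' x - \<eta>' y) = norm (\<eta> x - \<eta> y) / K"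
      using K by (simp add: \<eta>'_def norm_divide flip: diff_divide_distrib)
    then show "norm (\<eta>' x - \<eta>' y) \<le> 1 * norm (x - y)"
      using \<eta>(2)[of x y] K by (cases "K = 0") (auto simp: divide_le_eq mult.commute)
  qed (simp add: \<eta>'_def \<eta>(3))
  define Q where "Q x = lam * P x" for x
  have Q: "poly_deg d Q" unfolding Q_def by (rule poly_deg_cmult[OF P])
  define J where "J = osc_integrand Q n F \<eta>'"
  have Jm: "J \<in> borel_measurable borel"
    unfolding J_def using F(2) by (intro osc_integrand_measurable[where w = w, OF Q _ amp]) auto
  define a where "a = K * (\<Prod>j=1..n. L j)"
  define I where "I x = exp (\<i> * of_real (lam * P x)) * (\<Prod>j=1..n. f j (orth_proj (V j) x)) * \<eta> x" for x
  have "AE x in lebesgue. \<forall>j\<in>{1..n}. f j (orth_proj (V j) x) = of_real (L j) * F j x"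
    by (intro AE_finite_allI F(3)) auto
  then have IJ: "AE x in lebesgue. I x = of_real a * J x"
  proof eventually_elim
    case (elim x)
    then have "(\<Prod>j=1..n. f j (orth_proj (V j) x)) = of_real (\<Prod>j=1..n. L j) * (\<Prod>j=1..n. F j x)"
      by (simp add: prod.distrib)
    then show ?case
      by (simp add: I_def J_def osc_integrand_def Q_def a_def cis_conv_exp \<eta>'[of x] mult_ac)
  qed
  have a: "0 \<le> a" using K L by (simp add: a_def)
  have bound: "norm (integral\<^sup>L lborel J) \<le> C * max 1 \<bar>dir_deriv_prod w n Q x\<^sub>0\<bar> powr (- \<epsilon>)"
    unfolding J_def using F(2) by (intro decay_boundD(3)[OF decay Q _ amp x0]) auto
  have "norm (integral\<^sup>L lebesgue I) \<le> a * norm (integral\<^sup>L lborel J)"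
  \<comment> \<open>A function that is not measurable has integral 0 by convention, so the bound
    holds trivially in that case.\<close>
  proof (cases "I \<in> borel_measurable lebesgue")
    case True
    have "integral\<^sup>L lebesgue I = (\<integral>x. of_real a * J x \<partial>lebesgue)"
      by (rule integral_cong_AE[OF True _ IJ]) (use Jm in \<open>auto intro: measurable_completion\<close>)
    also have "\<dots> = (\<integral>x. of_real a * J x \<partial>lborel)"
      using Jm by (intro integral_completion) auto
    finally show ?thesis using a by (simp add: norm_mult)
  next
    case False
    then have "integral\<^sup>L lebesgue I = 0" by (intro not_integrable_integral_eq) auto
    then show ?thesis using a by simp
  qed
  also have "\<dots> \<le> a * (C * max 1 \<bar>dir_deriv_prod w n Q x\<^sub>0\<bar> powr (- \<epsilon>))"
    by (rule mult_left_mono[OF bound a])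
  also have "dir_deriv_prod w n Q x\<^sub>0 = lam * dir_deriv_prod w n P x\<^sub>0"
    unfolding Q_def[abs_def] by (simp add: dir_deriv_prod_cmult[OF P])
  finally show ?thesis
    by (simp add: osc_form_def I_def[abs_def] a_def L_def abs_mult mult_ac)
qed

section \<open>From normalised amplitudes and max 1 to C^1 norms and powers of 1 + |lam|\<close>

text \<open>A real supremum says something only for a bounded family, so the work lies in
  boundedness of both families in \<open>C1_norm\<close>, which follows from continuity and compact
  support. The Lipschitz bound is then the mean value inequality.\<close>

lemma C1_fun_bounds:
  fixes \<eta> :: "'a::euclidean_space \<Rightarrow> complex"
  assumes C1: "C1_fun \<eta>" and cpt: "compact (supp \<eta>)"
  shows "norm (\<eta> x) \<le> C1_norm \<eta>" "norm (\<eta> x - \<eta> y) \<le> C1_norm \<eta> * norm (x - y)"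
proof -
  let ?D = "\<lambda>x. frechet_derivative \<eta> (at x)"
  have der: "(\<eta> has_derivative ?D x) (at x)" for x
    using C1 frechet_derivative_works by (auto simp: C1_fun_def)
  have cont: "continuous_on UNIV (\<lambda>x. ?D x v)" for v using C1 by (simp add: C1_fun_def)
  have c\<eta>: "continuous_on UNIV \<eta>"
    using der has_derivative_continuous continuous_at_imp_continuous_on by blast
  have out: "\<eta> x = 0" if "x \<notin> supp \<eta>" for x
    using that closure_subset[of "{x. \<eta> x \<noteq> 0}"] by (auto simp: supp_def)
  have Dout: "?D x v = 0" if "x \<notin> supp \<eta>" for x v
  proof -
    have "open (- supp \<eta>)" by (simp add: supp_def open_Compl)
    moreover have "x \<in> - supp \<eta>" using that by simp
    ultimately have "(\<eta> has_derivative (\<lambda>_. 0)) (at x)"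
      by (rule has_derivative_transform_within_open[OF has_derivative_const[of 0]]) (simp add: out)
    from fun_cong[OF frechet_derivative_at[OF this], of v] show ?thesis by simp
  qed
  have bdd: "\<exists>B. \<forall>x. norm (h x) \<le> B" if h: "continuous_on UNIV h" "\<And>x. x \<notin> supp \<eta> \<Longrightarrow> h x = 0"
    for h :: "'a \<Rightarrow> complex"
  proof -
    have "compact (h ` supp \<eta>)"
      using cpt h(1) by (intro compact_continuous_image) (auto intro: continuous_on_subset)
    then obtain B where "\<forall>z\<in>h ` supp \<eta>. norm z \<le> B" using compact_imp_bounded bounded_iff by blast
    then have "norm (h x) \<le> max B 0" for x using h(2)[of x] by (cases "x \<in> supp \<eta>") (auto intro: max.coboundedI1)
    then show ?thesis by blast
  qed
  have b1: "bdd_above (range (\<lambda>x. norm (\<eta> x)))"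
    using bdd[OF c\<eta> out] by (auto intro: bdd_aboveI2)
  \<comment> \<open>\<open>C1_fun\<close> gives continuity of the derivative in each fixed direction
    only; the operator norm is bounded by summing over the basis directions.\<close>
  have b2: "bdd_above (range (\<lambda>x. onorm (?D x)))"
  proof -
    have "\<exists>B. \<forall>v x. norm (?D x v) \<le> B v" using bdd[OF cont Dout] by metis
    then obtain B where B: "\<And>v x. norm (?D x v) \<le> B v" by blast
    have "onorm (?D x) \<le> (\<Sum>b\<in>Basis. B b)" for x
      using onorm_componentwise[OF has_derivative_bounded_linear[OF der]] B
      by (rule order_trans[OF _ sum_mono])
    then show ?thesis by (rule bdd_aboveI2)
  qed
  define S\<^sub>1 where "S\<^sub>1 = (SUP x. norm (\<eta> x))"
  define S\<^sub>2 where "S\<^sub>2 = (SUP x. onorm (?D x))"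
  have S1: "norm (\<eta> x) \<le> S\<^sub>1" for x unfolding S\<^sub>1_def by (rule cSUP_upper[OF UNIV_I b1])
  have S2: "onorm (?D x) \<le> S\<^sub>2" for x unfolding S\<^sub>2_def by (rule cSUP_upper[OF UNIV_I b2])
  have S0: "0 \<le> S\<^sub>1" "0 \<le> S\<^sub>2"
    using S1[of 0] S2[of 0] onorm_pos_le[OF has_derivative_bounded_linear[OF der[of 0]]] norm_ge_zero[of "\<eta> 0"]
    by linarith+
  have C1n: "C1_norm \<eta> = S\<^sub>1 + S\<^sub>2" by (simp add: C1_norm_def S\<^sub>1_def S\<^sub>2_def)
  show "norm (\<eta> x) \<le> C1_norm \<eta>" using S1[of x] S0 C1n by linarith
  have "norm (\<eta> x - \<eta> y) \<le> S\<^sub>2 * norm (x - y)"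
    by (rule differentiable_bound[OF convex_UNIV der S2]) auto
  also have "\<dots> \<le> C1_norm \<eta> * norm (x - y)" unfolding C1n using S0 by (intro mult_right_mono) auto
  finally show "norm (\<eta> x - \<eta> y) \<le> C1_norm \<eta> * norm (x - y)" .
qed

text \<open>Because 1 + t = 1 + (t c) / c is at most (1 + 1 / c) max 1 (t c). It is applied with t =
  |lam| and c the lower bound for the derivative.\<close>

lemma max_1_powr_le:
  fixes t c \<epsilon> :: real
  assumes "0 < c" "0 < \<epsilon>" "0 \<le> t"
  shows "max 1 (t * c) powr (- \<epsilon>) \<le> (1 + 1 / c) powr \<epsilon> * (1 + t) powr (- \<epsilon>)"
proof -
  have "1 + t = 1 + 1 / c * (t * c)" using assms by (simp add: field_simps)
  also have "\<dots> \<le> max 1 (t * c) + 1 / c * max 1 (t * c)"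
    using assms by (intro add_mono mult_left_mono) auto
  also have "\<dots> = (1 + 1 / c) * max 1 (t * c)" by (simp add: distrib_right)
  finally have "(1 + t) / (1 + 1 / c) \<le> max 1 (t * c)"
    using assms by (simp add: divide_le_eq add_pos_pos mult.commute)
  then have "max 1 (t * c) powr (- \<epsilon>) \<le> ((1 + t) / (1 + 1 / c)) powr (- \<epsilon>)"
    using assms by (intro powr_mono2') (auto intro!: divide_pos_pos add_pos_pos add_pos_nonneg)
  also have "\<dots> = (1 + 1 / c) powr \<epsilon> * (1 + t) powr (- \<epsilon>)"
  proof -
    have "(y / b) powr (- \<epsilon>) = b powr \<epsilon> * y powr (- \<epsilon>)" if "0 < y" "0 < b" for y b :: real
      using that by (simp add: powr_minus powr_divide) (simp add: divide_inverse)
    then show ?thesis using assms by (simp add: add_pos_pos add_pos_nonneg)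
  qed
  finally show ?thesis .
qed

text \<open>Common source of both halves of the theorem: the constants are chosen before P, the
  point, \<eta>, f and lam. A fixed polynomial gives the power decay property; \<rho> = 1 gives the
  uniform statement.\<close>

lemma osc_form_power_decay:
  fixes V :: "nat \<Rightarrow> 'a::euclidean_space set"
  assumes "1 \<le> n" and V: "\<And>j. j \<in> {1..n} \<Longrightarrow> subspace (V j)"
    and w: "\<And>j. j \<in> {1..n} \<Longrightarrow> w j \<in> (V j)\<^sup>\<bottom>" and "compact K" "0 < c"
  shows "\<exists>A \<epsilon>. 0 < \<epsilon> \<and> (\<forall>P x\<^sub>0 \<eta> f lam. poly_deg d P \<longrightarrow> norm x\<^sub>0 \<le> \<rho> \<longrightarrow>
     c \<le> \<bar>dir_deriv_prod w n P x\<^sub>0\<bar> \<longrightarrow> C1_fun \<eta> \<longrightarrow> supp \<eta> \<subseteq> K \<longrightarrow> (\<forall>j\<in>{1..n}. f j \<in> Linf (V j)) \<longrightarrow>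
     norm (osc_form V n P \<eta> lam f)
       \<le> A * C1_norm \<eta> * (1 + \<bar>lam\<bar>) powr (- \<epsilon>) * (\<Prod>j=1..n. Linf_norm (V j) (f j)))"
proof -
  obtain R where R: "\<And>x. x \<in> K \<Longrightarrow> norm x \<le> R"
    using compact_imp_bounded[OF \<open>compact K\<close>] by (auto simp: bounded_iff)
  obtain C \<epsilon> where decay: "decay_bound w n d R 1 \<rho> C \<epsilon>"
    using decay_bound_exists[OF assms(1)] by blast
  have C: "0 \<le> C" "0 < \<epsilon>" using decay_boundD[OF decay] by auto
  have "norm (osc_form V n P \<eta> lam f)
       \<le> C * (1 + 1 / c) powr \<epsilon> * C1_norm \<eta> * (1 + \<bar>lam\<bar>) powr (- \<epsilon>) * (\<Prod>j=1..n. Linf_norm (V j) (f j))"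
    if P: "poly_deg d P" and x0: "norm x\<^sub>0 \<le> \<rho>" and c: "c \<le> \<bar>dir_deriv_prod w n P x\<^sub>0\<bar>"
      and \<eta>: "C1_fun \<eta>" and supp: "supp \<eta> \<subseteq> K" and f: "\<forall>j\<in>{1..n}. f j \<in> Linf (V j)" for P x\<^sub>0 \<eta> f lam
  proof -
    have "closed (supp \<eta>)" by (simp add: supp_def)
    then have "compact (supp \<eta>)" using compact_Int_closed[OF \<open>compact K\<close>] supp by (metis inf.absorb_iff2)
    note b = C1_fun_bounds[OF \<eta> this]
    have out: "\<eta> x = 0" if "norm x > R" for x
    proof -
      have "x \<notin> supp \<eta>" using R[of x] supp that by auto
      then show ?thesis using closure_subset[of "{x. \<eta> x \<noteq> 0}"] by (auto simp: supp_def)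
    qed
    have C1: "0 \<le> C1_norm \<eta>" using b(1) norm_ge_zero order_trans by blast
    have L: "0 \<le> (\<Prod>j=1..n. Linf_norm (V j) (f j))"
    proof (intro prod_nonneg ballI)
      fix j assume "j \<in> {1..n}"
      with f V w show "0 \<le> Linf_norm (V j) (f j)"
        by (meson Linf_invariant_factor)
    qed
    have "norm (osc_form V n P \<eta> lam f) \<le> C1_norm \<eta> * C *
        max 1 (\<bar>lam\<bar> * \<bar>dir_deriv_prod w n P x\<^sub>0\<bar>) powr (- \<epsilon>) * (\<Prod>j=1..n. Linf_norm (V j) (f j))"
      using f by (intro osc_form_bound[OF decay V w P x0 _ b out]) auto
    also have "\<dots> \<le> C1_norm \<eta> * C * ((1 + 1 / c) powr \<epsilon> * (1 + \<bar>lam\<bar>) powr (- \<epsilon>)) * (\<Prod>j=1..n. Linf_norm (V j) (f j))"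
    proof (intro mult_right_mono mult_left_mono)
      have "max 1 (\<bar>lam\<bar> * \<bar>dir_deriv_prod w n P x\<^sub>0\<bar>) powr (- \<epsilon>) \<le> max 1 (\<bar>lam\<bar> * c) powr (- \<epsilon>)"
        using c C by (intro powr_mono2' max.mono mult_left_mono) auto
      also have "\<dots> \<le> (1 + 1 / c) powr \<epsilon> * (1 + \<bar>lam\<bar>) powr (- \<epsilon>)"
        using assms(5) C(2) by (intro max_1_powr_le) auto
      finally show "max 1 (\<bar>lam\<bar> * \<bar>dir_deriv_prod w n P x\<^sub>0\<bar>) powr (- \<epsilon>)
          \<le> (1 + 1 / c) powr \<epsilon> * (1 + \<bar>lam\<bar>) powr (- \<epsilon>)" .
    qed (use C C1 L in auto)
    finally show ?thesis by (simp add: mult_ac)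
  qed
  with C(2) show ?thesis by blast
qed

theorem theorem2p3:
  fixes V :: "nat \<Rightarrow> (real ^ 'm) set" and n \<kappa> :: nat
  assumes "CARD('m) \<ge> 2"
    and "1 \<le> \<kappa>" and "\<kappa> \<le> CARD('m) - 1"
    and "n \<ge> 1"
    and "\<And>j. j \<in> {1..n} \<Longrightarrow> subspace (V j)"
    and "\<And>j. j \<in> {1..n} \<Longrightarrow> dim (V j) = \<kappa>"
  shows "(\<forall>(P :: real ^ 'm \<Rightarrow> real) U.
            real_polynomial_function P \<and> simply_nondegenerate V n P \<and> open U \<longrightarrow>
            power_decay V n P U) \<and>
         (\<forall>(d :: nat) (c :: real) (\<eta> :: real ^ 'm \<Rightarrow> complex) (w :: nat \<Rightarrow> real ^ 'm).
            c > 0 \<and> C1_fun \<eta> \<and> compact (supp \<eta>) \<and>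
            (\<forall>j\<in>{1..n}. w j \<in> (V j)\<^sup>\<bottom> \<and> norm (w j) = 1) \<longrightarrow>
            (\<exists>(C :: real) \<epsilon>. \<epsilon> > 0 \<and>
               (\<forall>P. poly_degree_le d P \<and>
                    (SUP x\<in>cball 0 1. \<bar>dir_deriv_prod w n P x\<bar>) \<ge> c \<longrightarrow>
                    (\<forall>f lam. (\<forall>j\<in>{1..n}. f j \<in> Linf (V j)) \<longrightarrow>
                       norm (osc_form V n P \<eta> lam f)
                         \<le> C * (1 + \<bar>lam\<bar>) powr (- \<epsilon>) * (\<Prod>j=1..n. Linf_norm (V j) (f j))))))"
proof (intro conjI allI impI; elim conjE)
  fix P :: "real ^ 'm \<Rightarrow> real" and U :: "(real ^ 'm) set"
  assume "real_polynomial_function P" and nondeg: "simply_nondegenerate V n P"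
  then obtain d where P: "poly_deg d P" using poly_deg_if_real_polynomial_function by blast
  obtain w x\<^sub>0 where w: "\<And>j. j \<in> {1..n} \<Longrightarrow> w j \<in> (V j)\<^sup>\<bottom>" and x0: "dir_deriv_prod w n P x\<^sub>0 \<noteq> 0"
    using nondeg unfolding simply_nondegenerate_def by blast
  have *: "\<exists>\<epsilon>>0. \<exists>A. \<forall>\<eta>. C1_fun \<eta> \<and> supp \<eta> \<subseteq> K \<longrightarrow>
           (\<forall>f lam. (\<forall>j\<in>{1..n}. f j \<in> Linf (V j)) \<longrightarrow>
              norm (osc_form V n P \<eta> lam f)
                \<le> A * C1_norm \<eta> * (1 + \<bar>lam\<bar>) powr (- \<epsilon>) * (\<Prod>j=1..n. Linf_norm (V j) (f j)))"
    if K: "compact K" for K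
  proof -
    \<comment> \<open>For one fixed P, the value at a point of nonvanishing is itself the lower
      bound, and \<rho> is the norm of that point.\<close>
    have c: "0 < \<bar>dir_deriv_prod w n P x\<^sub>0\<bar>" using x0 by simp
    obtain A \<epsilon> where "0 < \<epsilon>" and A: "\<And>\<eta> f lam. C1_fun \<eta> \<Longrightarrow> supp \<eta> \<subseteq> K \<Longrightarrow>
       (\<forall>j\<in>{1..n}. f j \<in> Linf (V j)) \<Longrightarrow> norm (osc_form V n P \<eta> lam f)
         \<le> A * C1_norm \<eta> * (1 + \<bar>lam\<bar>) powr (- \<epsilon>) * (\<Prod>j=1..n. Linf_norm (V j) (f j))"
      using osc_form_power_decay[where V = V and w = w and d = d and \<rho> = "norm x\<^sub>0", OF assms(4,5) w K c]
        P order_refl[of "norm x\<^sub>0"] order_refl[of "\<bar>dir_deriv_prod w n P x\<^sub>0\<bar>"] by blast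
    then show ?thesis by blast
  qed
  show "power_decay V n P U"
    unfolding power_decay_def
  proof (intro conjI allI impI; elim conjE)
    fix \<eta> :: "real ^ 'm \<Rightarrow> complex" assume \<eta>: "C1_fun \<eta>" "compact (supp \<eta>)"
    show "\<exists>\<epsilon>>0. \<exists>C. \<forall>f lam. (\<forall>j\<in>{1..n}. f j \<in> Linf (V j)) \<longrightarrow>
           norm (osc_form V n P \<eta> lam f)
             \<le> C * (1 + \<bar>lam\<bar>) powr (- \<epsilon>) * (\<Prod>j=1..n. Linf_norm (V j) (f j))"
    proof -
      obtain A \<epsilon> where "0 < \<epsilon>" and A: "\<And>f lam. (\<forall>j\<in>{1..n}. f j \<in> Linf (V j)) \<Longrightarrow>
         norm (osc_form V n P \<eta> lam f)
           \<le> A * C1_norm \<eta> * (1 + \<bar>lam\<bar>) powr (- \<epsilon>) * (\<Prod>j=1..n. Linf_norm (V j) (f j))"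
        using *[OF \<eta>(2)] \<eta>(1) by blast
      then show ?thesis by (intro exI[of _ \<epsilon>] conjI exI[of _ "A * C1_norm \<eta>"]) auto
    qed
  qed (rule *)
next
  fix d :: nat and c :: real and \<eta> :: "real ^ 'm \<Rightarrow> complex" and w :: "nat \<Rightarrow> real ^ 'm"
  assume c: "c > 0" and \<eta>: "C1_fun \<eta>" "compact (supp \<eta>)"
    and "\<forall>j\<in>{1..n}. w j \<in> (V j)\<^sup>\<bottom> \<and> norm (w j) = 1"
  then have w: "\<And>j. j \<in> {1..n} \<Longrightarrow> w j \<in> (V j)\<^sup>\<bottom>" by blast
  obtain A \<epsilon> where \<epsilon>: "0 < \<epsilon>" and A: "\<And>P x\<^sub>0 f lam. poly_deg d P \<Longrightarrow> norm x\<^sub>0 \<le> 1 \<Longrightarrow>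
     c \<le> \<bar>dir_deriv_prod w n P x\<^sub>0\<bar> \<Longrightarrow> (\<forall>j\<in>{1..n}. f j \<in> Linf (V j)) \<Longrightarrow>
     norm (osc_form V n P \<eta> lam f)
       \<le> A * C1_norm \<eta> * (1 + \<bar>lam\<bar>) powr (- \<epsilon>) * (\<Prod>j=1..n. Linf_norm (V j) (f j))"
    using osc_form_power_decay[where V = V and w = w and d = d and \<rho> = 1, OF assms(4,5) w \<eta>(2) c] \<eta>(1)
    by blast
  have "\<exists>x\<^sub>0. norm x\<^sub>0 \<le> 1 \<and> c \<le> \<bar>dir_deriv_prod w n P x\<^sub>0\<bar>"
    if P: "poly_deg d P" and sup: "c \<le> (SUP x\<in>cball 0 1. \<bar>dir_deriv_prod w n P x\<bar>)" for P
  proof -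
    \<comment> \<open>The supremum over the compact ball is attained, and a maximum point serves as
      the single point of evaluation.\<close>
    have "continuous_on (cball 0 1) (\<lambda>x. \<bar>dir_deriv_prod w n P x\<bar>)"
      by (intro continuous_on_rabs poly_deg_continuous_on[OF poly_deg_dir_deriv_prod[OF P]])
    from continuous_attains_sup[OF compact_cball _ this] obtain x\<^sub>0 where x0: "x\<^sub>0 \<in> cball 0 1"
      "\<And>x. x \<in> cball 0 1 \<Longrightarrow> \<bar>dir_deriv_prod w n P x\<bar> \<le> \<bar>dir_deriv_prod w n P x\<^sub>0\<bar>"
      by auto
    have "(SUP x\<in>cball 0 1. \<bar>dir_deriv_prod w n P x\<bar>) \<le> \<bar>dir_deriv_prod w n P x\<^sub>0\<bar>"
      by (rule cSUP_least) (use x0 in auto)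
    then show ?thesis using x0(1) sup by (intro exI[of _ x\<^sub>0]) auto
  qed
  then show "\<exists>C \<epsilon>. \<epsilon> > 0 \<and>
               (\<forall>P. poly_degree_le d P \<and>
                    (SUP x\<in>cball 0 1. \<bar>dir_deriv_prod w n P x\<bar>) \<ge> c \<longrightarrow>
                    (\<forall>f lam. (\<forall>j\<in>{1..n}. f j \<in> Linf (V j)) \<longrightarrow>
                       norm (osc_form V n P \<eta> lam f)
                         \<le> C * (1 + \<bar>lam\<bar>) powr (- \<epsilon>) * (\<Prod>j=1..n. Linf_norm (V j) (f j))))"
    using \<epsilon> A poly_deg_if_poly_degree_le by (intro exI[of _ "A * C1_norm \<eta>"] exI[of _ \<epsilon>]) blast
qed

end
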